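(* Let $\tilde\eta,\tilde\nu,\tilde\tau$ be non-negative functions, analytic in a neighborhood of $0$, with Taylor expansions as in Assumption A of the context and constant coefficients $\eta_0,\nu_0,\tau_0$. Consider algorithm $(\mathcal A)$ (defined in the context) with $\eta=\tilde\eta(\sqrt q)$, $\nu=\tilde\nu(\sqrt q)$, $\tau=\tilde\tau(\sqrt q)$, where $q=\mu s$. (i) If $\nu_0,\tau_0>0$, $\nu_0\ne\tau_0$ and $0\le\eta_0<\nu_0\tau_0/2$, then there exist constants $C,C_0,C_1>0$, depending only on $(\tilde\eta,\tilde\nu,\tilde\tau)$, such that for all $0<\mu\le L$, all $f\in\mathcal S^1_{\mu,L}$, all $x_0\in\mathbb R^n$, all $0<s\le C_0\,\mu/L^2$ and all $k\ge1$, the iterates of $(\mathcal A)$ satisfy $$f(x_k)-f^*\le C\,L\,\|x_0-x^*\|^2(1-C_1\sqrt{\mu s})^k.\qquad(1)$$ (ii) If $\nu_0,\tau_0>0$, $\nu_0\ne\tau_0$ and $\eta_0\ge\nu_0\tau_0/2$, then there exist constants $C,C_0,C_1>0$, depending only on $(\tilde\eta,\tilde\nu,\tilde\tau)$, such that for all $0<\mu\le L$, all $f\in\mathcal S^1_{\mu,L}$, all $x_0\in\mathbb R^n$, all $0<s\le C_0/L$ and all $k\ge1$, the iterates of $(\mathcal A)$ satisfy (1).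
   Context: For $0<\mu\le L$, $\mathcal S^1_{\mu,L}$ is the set of continuously differentiable convex functions $f:\mathbb R^n\to\mathbb R$ that are $L$-smooth ($\|\nabla f(y)-\nabla f(x)\|\le L\|y-x\|$ for all $x,y$) and $\mu$-strongly convex ($f(y)\ge f(x)+\langle\nabla f(x),y-x\rangle+\frac{\mu}{2}\|y-x\|^2$ for all $x,y$); $\|\cdot\|$ is the Euclidean norm. $x^*$ is the unique minimizer of $f$ and $f^*=f(x^* )$. For a stepsize $s>0$ put $q=\mu s$. Algorithm $(\mathcal A)$ with parameters $\eta,\nu,\tau\ge0$: starting from $x_0=z_0\in\mathbb R^n$, for $k\ge0$, $$y_{k+1}=x_k-\eta s\nabla f(x_k),$$ $$z_{k+1}=\nu\sqrt q\,\Big(x_k-\frac1\mu\nabla f(x_k)\Big)+(1-\nu\sqrt q)z_k,$$ $$x_{k+1}=\frac{\tau\sqrt q}{1+\sqrt q}z_{k+1}+\Big(1-\frac{\tau\sqrt q}{1+\sqrt q}\Big)y_{k+1}.$$ Assumption A: there are non-negative functions $\tilde\eta,\tilde\nu,\tilde\tau$, analytic in a neighborhood of $0$, such that $\eta=\tilde\eta(\sqrt q)$, $\nu=\tilde\nu(\sqrt q)$, $\tau=\tilde\tau(\sqrt q)$; thus $\eta=\sum_{i\ge0}\eta_i(\sqrt q)^i$, $\nu=\sum_{i\ge0}\nu_i(\sqrt q)^i$, $\tau=\sum_{i\ge0}\tau_i(\sqrt q)^i$ are convergent expansions for $0\le q\le q_0$, for some constant $q_0>0$. *)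

theory Defs
  imports "HOL-Analysis.Analysis"
begin

text \<open>
  The constants in the theorem must not depend on the dimension \<open>n\<close>, so \<open>n\<close> has to be
  quantified inside the formula and cannot be a type parameter as in \<open>real ^ 'n\<close>. We therefore use
  a single inner product space containing every \<open>\<real>\<^sup>n\<close>: the finitely supported real sequences
  with the standard inner product. \<open>\<real>\<^sup>n\<close> is the subspace of the sequences supported on
  \<open>{0..<n}\<close>.
\<close>

typedef fseq = "{x :: nat \<Rightarrow> real. finite {i. x i \<noteq> 0}}"
  morphisms coord Abs_fseq
proof
  show "(\<lambda>_. 0) \<in> {x :: nat \<Rightarrow> real. finite {i. x i \<noteq> 0}}" by simp
qed

setup_lifting type_definition_fseq

lemma finite_coord: "finite {i. coord x i \<noteq> 0}"
  using coord[of x] by simp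

lemma fseq_eqI: "(\<And>i. coord x i = coord y i) \<Longrightarrow> x = y"
  by (metis coord_inject ext)

instantiation fseq :: real_vector
begin

lift_definition zero_fseq :: fseq is "\<lambda>_. 0" by simp

lift_definition plus_fseq :: "fseq \<Rightarrow> fseq \<Rightarrow> fseq" is "\<lambda>x y i. x i + y i"
proof -
  fix x y :: "nat \<Rightarrow> real"
  assume "finite {i. x i \<noteq> 0}" "finite {i. y i \<noteq> 0}"
  then have "finite ({i. x i \<noteq> 0} \<union> {i. y i \<noteq> 0})" by simp
  then show "finite {i. x i + y i \<noteq> 0}" by (rule rev_finite_subset) auto
qed

lift_definition minus_fseq :: "fseq \<Rightarrow> fseq \<Rightarrow> fseq" is "\<lambda>x y i. x i - y i"
proof -
  fix x y :: "nat \<Rightarrow> real"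
  assume "finite {i. x i \<noteq> 0}" "finite {i. y i \<noteq> 0}"
  then have "finite ({i. x i \<noteq> 0} \<union> {i. y i \<noteq> 0})" by simp
  then show "finite {i. x i - y i \<noteq> 0}" by (rule rev_finite_subset) auto
qed

lift_definition uminus_fseq :: "fseq \<Rightarrow> fseq" is "\<lambda>x i. - x i" by simp

lift_definition scaleR_fseq :: "real \<Rightarrow> fseq \<Rightarrow> fseq" is "\<lambda>r x i. r * x i"
proof -
  fix r :: real and x :: "nat \<Rightarrow> real"
  assume "finite {i. x i \<noteq> 0}"
  then show "finite {i. r * x i \<noteq> 0}" by (rule rev_finite_subset) auto
qed

instance
  by standard (transfer; simp add: fun_eq_iff algebra_simps)+

end

lemma coord_simps [simp]:
  "coord 0 i = 0"
  "coord (x + y) i = coord x i + coord y i"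
  "coord (x - y) i = coord x i - coord y i"
  "coord (- x) i = - coord x i"
  "coord (r *\<^sub>R x) i = r * coord x i"
  by (transfer; simp)+

instantiation fseq :: real_inner
begin

definition inner_fseq :: "fseq \<Rightarrow> fseq \<Rightarrow> real" where
  "inner_fseq x y = (\<Sum>i | coord x i \<noteq> 0. coord x i * coord y i)"

definition norm_fseq :: "fseq \<Rightarrow> real" where
  "norm_fseq x = sqrt (inner x x)"

definition sgn_fseq :: "fseq \<Rightarrow> fseq" where
  "sgn_fseq x = x /\<^sub>R norm x"

definition dist_fseq :: "fseq \<Rightarrow> fseq \<Rightarrow> real" where
  "dist_fseq x y = norm (x - y)"

definition uniformity_fseq :: "(fseq \<times> fseq) filter" where
  "uniformity_fseq = (INF e\<in>{0<..}. principal {(x, y). dist x y < e})"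

definition open_fseq :: "fseq set \<Rightarrow> bool" where
  "open_fseq U \<longleftrightarrow> (\<forall>x\<in>U. \<forall>\<^sub>F (x', y) in uniformity. x' = x \<longrightarrow> y \<in> U)"

lemma inner_fseq_superset:
  assumes "finite A" "{i. coord x i \<noteq> 0} \<subseteq> A"
  shows "inner x y = (\<Sum>i\<in>A. coord x i * coord y i)"
  unfolding inner_fseq_def using assms by (intro sum.mono_neutral_left) auto

instance
proof
  fix x y z :: fseq and r :: real
  define A where
    "A = {i. coord x i \<noteq> 0} \<union> {i. coord y i \<noteq> 0} \<union> {i. coord z i \<noteq> 0}"
  have A: "finite A" by (simp add: A_def finite_coord)
  note [simp] = inner_fseq_superset[OF A]
  have sub: "{i. coord x i \<noteq> 0} \<subseteq> A" "{i. coord y i \<noteq> 0} \<subseteq> A"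
    "{i. coord (x + y) i \<noteq> 0} \<subseteq> A" "{i. coord (r *\<^sub>R x) i \<noteq> 0} \<subseteq> A"
    by (auto simp: A_def)
  show "inner x y = inner y x"
    using sub by (simp add: mult.commute)
  show "inner (x + y) z = inner x z + inner y z"
    using sub by (simp add: sum.distrib distrib_right)
  show "inner (r *\<^sub>R x) y = r * inner x y"
    using sub by (simp add: sum_distrib_left mult.assoc)
  show "0 \<le> inner x x"
    by (simp add: inner_fseq_def sum_nonneg)
  show "inner x x = 0 \<longleftrightarrow> x = 0"
  proof
    assume "inner x x = 0"
    then have "\<forall>i\<in>{i. coord x i \<noteq> 0}. coord x i * coord x i = 0"
      unfolding inner_fseq_def by (subst (asm) sum_nonneg_eq_0_iff) (auto simp: finite_coord)
    then show "x = 0" by (intro fseq_eqI) auto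
  qed (simp add: inner_fseq_def)
qed (simp_all add: norm_fseq_def sgn_fseq_def dist_fseq_def uniformity_fseq_def open_fseq_def)

end

definition Rn :: "nat \<Rightarrow> fseq set" where
  "Rn n = {x. \<forall>i\<ge>n. coord x i = 0}"

lemma inner_Rn: "x \<in> Rn n \<Longrightarrow> inner x y = (\<Sum>i<n. coord x i * coord y i)"
  by (rule inner_fseq_superset) (auto simp: Rn_def not_le[symmetric])

lemma norm_Rn: "x \<in> Rn n \<Longrightarrow> norm x = sqrt (\<Sum>i<n. (coord x i)\<^sup>2)"
  by (simp add: norm_fseq_def inner_Rn power2_eq_square)

lemma subspace_Rn: "subspace (Rn n)"
  by (auto simp: subspace_def Rn_def)

text \<open>
  A function \<open>\<real>\<^sup>n \<rightarrow> \<real>\<close> is represented by any \<open>f :: fseq \<Rightarrow> real\<close>; only its values on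
  \<open>Rn n\<close> matter, and derivatives are taken within \<open>Rn n\<close>.
\<close>

definition grad :: "nat \<Rightarrow> (fseq \<Rightarrow> real) \<Rightarrow> fseq \<Rightarrow> fseq" where
  "grad n f x = (THE g. g \<in> Rn n \<and> (f has_derivative (\<lambda>h. inner g h)) (at x within Rn n))"

definition S1 :: "nat \<Rightarrow> real \<Rightarrow> real \<Rightarrow> (fseq \<Rightarrow> real) set" where
  "S1 n \<mu> L = {f.
     f differentiable_on Rn n \<and> continuous_on (Rn n) (grad n f) \<and>
     convex_on (Rn n) f \<and>
     (\<forall>x\<in>Rn n. \<forall>y\<in>Rn n. norm (grad n f y - grad n f x) \<le> L * norm (y - x)) \<and>
     (\<forall>x\<in>Rn n. \<forall>y\<in>Rn n.
        f y \<ge> f x + inner (grad n f x) (y - x) + \<mu> / 2 * (norm (y - x))\<^sup>2)}"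

definition algorithm_A ::
  "nat \<Rightarrow> (fseq \<Rightarrow> real) \<Rightarrow> real \<Rightarrow> real \<Rightarrow> real \<Rightarrow> real \<Rightarrow> real \<Rightarrow>
   (nat \<Rightarrow> fseq) \<Rightarrow> (nat \<Rightarrow> fseq) \<Rightarrow> (nat \<Rightarrow> fseq) \<Rightarrow> bool" where
  "algorithm_A n f \<mu> s \<eta> \<nu> \<tau> x y z \<longleftrightarrow>
     x 0 \<in> Rn n \<and> z 0 = x 0 \<and>
     (let q = \<mu> * s in \<forall>k.
        y (Suc k) = x k - (\<eta> * s) *\<^sub>R grad n f (x k) \<and>
        z (Suc k) = (\<nu> * sqrt q) *\<^sub>R (x k - (1 / \<mu>) *\<^sub>R grad n f (x k))
                      + (1 - \<nu> * sqrt q) *\<^sub>R z k \<and>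
        x (Suc k) = (\<tau> * sqrt q / (1 + sqrt q)) *\<^sub>R z (Suc k)
                      + (1 - \<tau> * sqrt q / (1 + sqrt q)) *\<^sub>R y (Suc k))"

text \<open>
  \<open>has_fps_expansion\<close> expresses that a function agrees near 0 with a power series of positive
  radius of convergence. The parameter functions are only evaluated at small \<open>sqrt q \<ge> 0\<close>, so
  non-negativity is required there only.
\<close>

definition parameter_function :: "(real \<Rightarrow> real) \<Rightarrow> real fps \<Rightarrow> bool" where
  "parameter_function \<phi> \<Phi> \<longleftrightarrow>
     \<phi> has_fps_expansion \<Phi> \<and> (\<exists>q\<^sub>0>0. \<forall>q. 0 \<le> q \<and> q \<le> q\<^sub>0 \<longrightarrow> 0 \<le> \<phi> (sqrt q))"

end

theory Submission
  imports Defs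
begin

text \<open>
  Put \<open>r = sqrt (\<mu> * s)\<close>, \<open>u = x - x\<^sup>*\<close>, \<open>v = z - x\<close>, and divide function values and gradients by
  \<open>\<mu>\<close>, giving \<open>F\<close> and \<open>G\<close>; write \<open>\<kappa> = L / \<mu>\<close>. The algorithm becomes
  \<open>u' = u + a r v' - \<eta> r\<^sup>2 G\<close>, \<open>v' = (1 - b r) v - c r G\<close>, where \<open>a, b, c\<close> tend to
  \<open>\<tau>\<^sub>0, \<nu>\<^sub>0 + \<tau>\<^sub>0, \<nu>\<^sub>0\<close> as \<open>r \<rightarrow> 0\<close>. The Lyapunov function is \<open>F\<close> plus a quadratic form
  \<open>A/2 |v|\<^sup>2 + B \<langle>v,u\<rangle> + D/2 |u|\<^sup>2\<close>: \<open>A\<close> is chosen to cancel \<open>\<langle>v,G\<rangle>\<close>, \<open>D\<close> to cancel \<open>\<langle>v,u\<rangle>\<close>, and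
  \<open>B\<close> is a small constant that produces the dissipation \<open>- r \<langle>G,u\<rangle>\<close>.

  In case (i) the descent inequality costs \<open>\<kappa> r\<^sup>2 |v|\<^sup>2\<close>, which the dissipation absorbs only when
  \<open>r \<kappa>\<close> is small, that is \<open>s \<le> C\<^sub>0 \<mu> / L\<^sup>2\<close>. In case (ii) \<open>F\<close> at step \<open>k\<close> is paired with \<open>v\<close> at
  step \<open>k + 1\<close> and \<open>u\<close> is replaced by \<open>u - \<eta> r\<^sup>2 G\<close>, so that only the new gradient occurs and convexity
  at the new point suffices; what remains is \<open>(a c / (2 (1 - b r)) - \<eta>) r\<^sup>2 |G|\<^sup>2\<close>. Its coefficient tends
  to \<open>\<nu>\<^sub>0 \<tau>\<^sub>0 / 2 - \<eta>\<^sub>0 \<le> 0\<close>, and the \<open>O(r)\<close> excess is absorbed by \<open>r \<langle>G,u\<rangle> \<ge> r |G|\<^sup>2 / (4 \<kappa>)\<close> once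
  \<open>\<kappa> r\<^sup>2 = s L\<close> is small.
\<close>

section \<open>Smooth strongly convex functions\<close>

text \<open>\<open>V\<close> is an arbitrary subspace and \<open>g\<close> an abstract map on it:
  the convergence argument runs on the subgradient and Lipschitz inequalities, and derivatives enter
  only when \<open>g\<close> is taken to be \<open>grad n f\<close> on \<open>Rn n\<close>.\<close>

locale smooth_strongly_convex =
  fixes V :: "'a::real_inner set" and f :: "'a \<Rightarrow> real" and g :: "'a \<Rightarrow> 'a"
    and \<mu> L :: real and p :: 'a
  assumes subspace: "subspace V"
    and mu_pos: "0 < \<mu>" and mu_le: "\<mu> \<le> L"
    and grad_in: "\<And>x. x \<in> V \<Longrightarrow> g x \<in> V"
    and lipschitz: "\<And>x y. x \<in> V \<Longrightarrow> y \<in> V \<Longrightarrow> norm (g y - g x) \<le> L * norm (y - x)"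
    and strongly_convex:
      "\<And>x y. x \<in> V \<Longrightarrow> y \<in> V \<Longrightarrow> f x + inner (g x) (y - x) + \<mu> / 2 * (norm (y - x))\<^sup>2 \<le> f y"
    and min_in: "p \<in> V" and min: "\<And>x. x \<in> V \<Longrightarrow> f p \<le> f x"
begin

lemma L_pos: "0 < L"
  using mu_pos mu_le by simp

lemma subgradient: "x \<in> V \<Longrightarrow> y \<in> V \<Longrightarrow> f x + inner (g x) (y - x) \<le> f y"
  using order.trans[OF _ strongly_convex[of x y]] mu_pos by simp

text \<open>
  The constants in the next two lemmas are a factor 2 off the optimal ones; in return the proofs use the
  gradient only through the subgradient inequality and its Lipschitz bound.
\<close>

lemma descent:
  assumes "x \<in> V" "y \<in> V"
  shows "f y \<le> f x + inner (g x) (y - x) + L * (norm (y - x))\<^sup>2"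
proof -
  have "f y + inner (g y) (x - y) \<le> f x"
    using subgradient assms by blast
  moreover have "inner (g y - g x) (y - x) \<le> norm (g y - g x) * norm (y - x)"
    by (rule norm_cauchy_schwarz)
  moreover have "norm (g y - g x) * norm (y - x) \<le> L * norm (y - x) * norm (y - x)"
    using lipschitz[OF assms] by (rule mult_right_mono) simp
  ultimately show ?thesis
    by (simp add: inner_diff_left inner_diff_right power2_eq_square mult.assoc)
qed

lemma gradient_gap:
  assumes "x \<in> V" "y \<in> V"
  shows "f x + inner (g x) (y - x) + (norm (g y - g x))\<^sup>2 / (4 * L) \<le> f y"
proof -
  define d where "d = g y - g x"
  \<comment> \<open>A gradient step from \<open>y\<close> for \<open>f\<close> tilted by
    \<open>inner (g x)\<close>, whose gradient at \<open>y\<close> is \<open>d\<close>. The length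
    \<open>1 / (2 * L)\<close> minimises the bound given by \<open>descent\<close>.\<close>
  define y' where "y' = y - (1 / (2 * L)) *\<^sub>R d"
  have y': "y' \<in> V"
    unfolding y'_def d_def using subspace assms grad_in by (intro subspace_diff subspace_scale)
  have "f x + inner (g x) (y' - x) \<le> f y'"
    using subgradient assms(1) y' by blast
  also have "f y' \<le> f y + inner (g y) (y' - y) + L * (norm (y' - y))\<^sup>2"
    using descent assms(2) y' by blast
  also have "(norm (y' - y))\<^sup>2 = (norm d)\<^sup>2 / (4 * L\<^sup>2)"
    by (simp add: y'_def power_divide power_mult_distrib)
  also have "L * ((norm d)\<^sup>2 / (4 * L\<^sup>2)) = (norm d)\<^sup>2 / (4 * L)"
    using L_pos by (simp add: power2_eq_square)
  finally have 1: "f x + inner (g x) (y' - x) \<le> f y + inner (g y) (y' - y) + (norm d)\<^sup>2 / (4 * L)" .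
  have "inner (g x) (y' - x) - inner (g y) (y' - y) = inner (g x) (y - x) - inner d (y' - y)"
    by (simp add: d_def inner_diff_left inner_diff_right)
  also have "inner d (y' - y) = - (norm d)\<^sup>2 / (2 * L)"
    by (simp add: y'_def power2_norm_eq_inner)
  finally show ?thesis
    using 1 by (simp add: d_def[symmetric])
qed

text \<open>Otherwise the step \<open>- (1 / (2 * L)) *\<^sub>R g p\<close>, which stays in
  \<open>V\<close>, would lower \<open>f\<close> by at least
  \<open>(norm (g p))\<^sup>2 / (4 * L)\<close>, against the minimality of \<open>p\<close>.\<close>

lemma gradient_min: "g p = 0"
proof -
  define y where "y = p - (1 / (2 * L)) *\<^sub>R g p"
  have y: "y \<in> V"
    unfolding y_def using subspace min_in grad_in by (intro subspace_diff subspace_scale)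
  have "f p \<le> f y" using min y by blast
  also have "f y \<le> f p + inner (g p) (y - p) + L * (norm (y - p))\<^sup>2"
    using descent min_in y by blast
  also have "inner (g p) (y - p) = - (norm (g p))\<^sup>2 / (2 * L)"
    by (simp add: y_def power2_norm_eq_inner)
  also have "L * (norm (y - p))\<^sup>2 = (norm (g p))\<^sup>2 / (4 * L)"
    using L_pos by (simp add: y_def power_divide power_mult_distrib power2_eq_square)
  finally have "(norm (g p))\<^sup>2 / (4 * L) \<le> 0" by simp
  then show ?thesis using L_pos by (simp add: divide_le_0_iff)
qed

end

section \<open>The Lyapunov function\<close>

text \<open>\<open>F\<close> is a plain number, so that both kinds of bookkeeping fit: function
  value, velocity and position at the same step, or a corrected function value with the velocity one
  step ahead and a shifted position.\<close>

definition energy :: "real \<Rightarrow> real \<Rightarrow> real \<Rightarrow> real \<Rightarrow> 'a::real_inner \<Rightarrow> 'a \<Rightarrow> real" where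
  "energy A B D F w u = F + A / 2 * (norm w)\<^sup>2 + B * inner w u + D / 2 * (norm u)\<^sup>2"

text \<open>Multiplied by \<open>A\<close>, the quadratic form in \<open>w\<close> and
  \<open>u\<close> becomes a complete square plus a multiple of \<open>(norm u)\<^sup>2\<close>,
  whose sign is that of the determinant \<open>A * D - B\<^sup>2\<close>.\<close>

lemma energy_ge:
  assumes "0 < A" "B\<^sup>2 \<le> A * D"
  shows "F \<le> energy A B D F w u"
proof -
  have "A * (A / 2 * (norm w)\<^sup>2 + B * inner w u + D / 2 * (norm u)\<^sup>2)
      = (norm (A *\<^sub>R w + B *\<^sub>R u))\<^sup>2 / 2 + (A * D - B\<^sup>2) / 2 * (norm u)\<^sup>2"
    by (simp add: power2_norm_eq_inner inner_simps inner_commute[of u w])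
       (simp add: field_simps power2_eq_square)
  also have "\<dots> \<ge> 0"
    using assms by simp
  finally show ?thesis
    using assms by (simp add: energy_def zero_le_mult_iff)
qed

lemma abs_inner_le: "2 * \<bar>inner u v\<bar> \<le> (norm u)\<^sup>2 + (norm v)\<^sup>2"
  using Cauchy_Schwarz_ineq2[of u v] sum_squares_bound[of "norm u" "norm v"] by simp

lemma energy_le:
  assumes "0 \<le> B"
  shows "energy A B D F w u \<le> F + (A + B) / 2 * (norm w)\<^sup>2 + (B + D) / 2 * (norm u)\<^sup>2"
proof -
  have "B * (2 * inner w u) \<le> B * ((norm w)\<^sup>2 + (norm u)\<^sup>2)"
    using assms abs_inner_le[of w u] by (intro mult_left_mono) auto
  then show ?thesis by (simp add: energy_def field_simps)
qed

lemma norm_add_square_le: "(norm (u + v))\<^sup>2 \<le> 2 * (norm u)\<^sup>2 + 2 * (norm (v::'a::real_inner))\<^sup>2"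
  using abs_inner_le[of u v] by (simp add: power2_norm_eq_inner inner_simps inner_commute[of v u])

section \<open>Decrease of the energy in one step\<close>

text \<open>In the application \<open>w\<close> is the velocity already updated once and
  \<open>t = u - (e * r\<^sup>2) *\<^sub>R G\<close>, so both updates contain only the new gradient
  \<open>G'\<close>. The old \<open>G\<close> survives only in \<open>convex\<close>, and the term
  \<open>e * r\<^sup>2 / 2 * (norm G)\<^sup>2\<close> subtracted from \<open>F\<close> makes it
  telescope.\<close>

lemma accelerated_step:
  fixes t w G G' :: "'a::real_inner"
  assumes t': "t' = t + (a * r) *\<^sub>R w - (e * r\<^sup>2) *\<^sub>R G'"
    and w': "w' = (1 - b * r) *\<^sub>R w - (c * r) *\<^sub>R G'"
    and convex: "F' \<le> F + inner G' ((a * r) *\<^sub>R w - (e * r\<^sup>2) *\<^sub>R G) - (norm (G' - G))\<^sup>2 / (4 * \<kappa>)"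
    and coercive: "F' + (norm G')\<^sup>2 / (4 * \<kappa>) \<le> inner G' (t' + (e * r\<^sup>2) *\<^sub>R G')"
    and F': "0 \<le> F'"
    and A: "A * (1 - b * r) * c = a" and D: "D * a = B * b"
    and pos: "0 < r" "0 \<le> A" "0 \<le> B" "0 \<le> D" "0 \<le> b" "b * r \<le> 1" "0 \<le> c" "0 \<le> e" "0 < \<kappa>"
    and step: "8 * e * (\<kappa> * r\<^sup>2) \<le> 1" "\<kappa> * r\<^sup>2 * (K + B * e\<^sup>2) \<le> B * c / 8"
    and K: "A * c\<^sup>2 / 2 - e \<le> K * r" and B: "B * (a + 1) \<le> A * b / 4"
  shows "energy A B D (F' - e * r\<^sup>2 / 2 * (norm G')\<^sup>2) w' t'
       \<le> energy A B D (F - e * r\<^sup>2 / 2 * (norm G)\<^sup>2) w t - r * (A * b / 4 * (norm w)\<^sup>2 + B * c * F')"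
proof -
  let ?W = "(norm w)\<^sup>2" and ?G = "(norm G')\<^sup>2"
  have sw: "inner G' w = inner w G'" "inner t w = inner w t" "inner t G' = inner G' t"
    "inner G' G = inner G G'"
    by (simp_all add: inner_commute)
  note expand = power2_norm_eq_inner inner_simps sw
  \<comment> \<open>The choice of \<open>A\<close> makes the cross term exactly
    \<open>- a * r * inner w G'\<close>, which cancels the one in fact \<open>4\<close>.\<close>
  have 1: "A / 2 * (norm w')\<^sup>2 = A / 2 * ?W - A / 2 * (b * r) * (2 - b * r) * ?W
      - a * r * inner w G' + A * c\<^sup>2 / 2 * r\<^sup>2 * ?G"
    unfolding w' A[symmetric] by (simp add: expand) (simp add: field_simps power2_eq_square)
  have 2: "B * inner w' t' = B * inner w t - B * b * r * inner w t' - B * c * r * inner G' t'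
      + B * a * r * ?W - B * e * r\<^sup>2 * inner w G'"
    unfolding w' t' by (simp add: expand) (simp add: field_simps power2_eq_square)
  \<comment> \<open>Expanded around \<open>t'\<close> rather than \<open>t\<close>: the remainder
    \<open>- D / 2 * (norm (t' - t))\<^sup>2\<close> then has the favourable sign, and
    \<open>D * a = B * b\<close> cancels \<open>inner w t'\<close> against fact
    \<open>2\<close>.\<close>
  have "D / 2 * (norm t')\<^sup>2 = D / 2 * (norm t)\<^sup>2 + D * a * r * inner w t'
      - D * e * r\<^sup>2 * inner G' t' - D / 2 * (norm (t' - t))\<^sup>2"
    unfolding t' by (simp add: expand) (simp add: field_simps power2_eq_square)
  then have 3: "D / 2 * (norm t')\<^sup>2 \<le> D / 2 * (norm t)\<^sup>2 + B * b * r * inner w t'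
      - D * e * r\<^sup>2 * inner G' t'"
    using pos D by simp
  have sq: "(norm (G' - G))\<^sup>2 = ?G - 2 * inner G G' + (norm G)\<^sup>2"
    by (simp add: expand)
  have "e * r\<^sup>2 / 2 * (norm (G' - G))\<^sup>2 \<le> (norm (G' - G))\<^sup>2 / (4 * \<kappa>)"
  proof -
    have "e * r\<^sup>2 / 2 \<le> 1 / (4 * \<kappa>)"
      using step(1) pos zero_le_mult_iff[of e "\<kappa> * r\<^sup>2"] by (simp add: field_simps)
    then have "e * r\<^sup>2 / 2 * (norm (G' - G))\<^sup>2 \<le> 1 / (4 * \<kappa>) * (norm (G' - G))\<^sup>2"
      by (rule mult_right_mono) simp
    then show ?thesis by simp
  qed
  \<comment> \<open>The gap term dominates
    \<open>e * r\<^sup>2 / 2 * (norm (G' - G))\<^sup>2\<close>, whose mixed part cancels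
    \<open>e * r\<^sup>2 * inner G' G\<close>; what remains turns both function values into their
    corrected forms and leaves the gain \<open>- e * r\<^sup>2 * ?G\<close>.\<close>
  then have 4: "F' - e * r\<^sup>2 / 2 * ?G \<le> F - e * r\<^sup>2 / 2 * (norm G)\<^sup>2 + a * r * inner w G' - e * r\<^sup>2 * ?G"
    using convex unfolding sq by (simp add: inner_simps sw algebra_simps)
  \<comment> \<open>Half of the gradient square in \<open>coercive\<close> pays for replacing the
    position by \<open>t'\<close>; the other half is kept to absorb, in fact \<open>12\<close>, the
    errors of order \<open>r ^ 3 * ?G\<close>.\<close>
  have 5: "F' + ?G / (8 * \<kappa>) \<le> inner G' t'"
  proof -
    have "e * r\<^sup>2 \<le> 1 / (8 * \<kappa>)"
      using step(1) pos by (simp add: field_simps)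
    then have "e * r\<^sup>2 * ?G \<le> 1 / (8 * \<kappa>) * ?G"
      by (rule mult_right_mono) simp
    then show ?thesis
      using coercive by (simp add: inner_simps power2_norm_eq_inner)
  qed
  then have "0 \<le> inner G' t'"
    using F' pos by (intro order.trans[OF _ 5]) simp
  then have 6: "0 \<le> D * e * r\<^sup>2 * inner G' t'"
    using pos by simp
  have 7: "B * c * r * (F' + ?G / (8 * \<kappa>)) \<le> B * c * r * inner G' t'"
    using 5 pos by (intro mult_left_mono) auto
  have 8: "- (B * e * r\<^sup>2 * inner w G') \<le> B * r * (?W + (e\<^sup>2 * r\<^sup>2) * ?G)"
  proof -
    have "- inner w ((e * r) *\<^sub>R G') \<le> ?W + (norm ((e * r) *\<^sub>R G'))\<^sup>2"
      using abs_inner_le[of w "(e * r) *\<^sub>R G'"]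
      zero_le_power2[of "norm w"] zero_le_power2[of "norm ((e * r) *\<^sub>R G')"]
      by linarith
    then have "B * r * (- inner w ((e * r) *\<^sub>R G')) \<le> B * r * (?W + (norm ((e * r) *\<^sub>R G'))\<^sup>2)"
      using pos by (intro mult_left_mono) auto
    then show ?thesis by (simp add: power_mult_distrib power2_eq_square mult_ac)
  qed
  have 9: "A / 2 * (b * r) * ?W \<le> A / 2 * (b * r) * (2 - b * r) * ?W"
  proof -
    have "A / 2 * (b * r) * 1 \<le> A / 2 * (b * r) * (2 - b * r)"
      using pos by (intro mult_left_mono) auto
    then show ?thesis by (intro mult_right_mono) auto
  qed
  have 1: "A / 2 * (norm w')\<^sup>2 \<le> A / 2 * ?W - A / 2 * (b * r) * ?W
      - a * r * inner w G' + A * c\<^sup>2 / 2 * r\<^sup>2 * ?G"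
    using 1 9 by linarith
  have 10: "B * (a + 1) * (r * ?W) \<le> A * b / 4 * (r * ?W)"
    using B pos by (intro mult_right_mono) auto
  \<comment> \<open>\<open>A * c\<^sup>2 / 2\<close> comes from the velocity and \<open>- e\<close>
    from fact \<open>4\<close>; their difference may be positive, but only of order
    \<open>r\<close>.\<close>
  have 11: "(A * c\<^sup>2 / 2 - e) * (r\<^sup>2 * ?G) \<le> K * r * (r\<^sup>2 * ?G)"
    using K by (intro mult_right_mono) auto
  have "r\<^sup>2 * (K + B * e\<^sup>2) \<le> B * c / (8 * \<kappa>)"
    using step(2) pos by (simp add: field_simps)
  then have 12: "r\<^sup>2 * (K + B * e\<^sup>2) * (r * ?G) \<le> B * c / (8 * \<kappa>) * (r * ?G)"
    using pos by (intro mult_right_mono) auto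
  have "energy A B D (F' - e * r\<^sup>2 / 2 * ?G) w' t'
     \<le> energy A B D (F - e * r\<^sup>2 / 2 * (norm G)\<^sup>2) w t
       - A / 2 * (b * r) * ?W + B * a * r * ?W + (A * c\<^sup>2 / 2 - e) * (r\<^sup>2 * ?G)
       - B * c * r * (F' + ?G / (8 * \<kappa>)) + B * r * (?W + (e\<^sup>2 * r\<^sup>2) * ?G)"
    unfolding energy_def using 1 2 3 4 6 7 8 by (simp add: algebra_simps)
  also have "\<dots> = energy A B D (F - e * r\<^sup>2 / 2 * (norm G)\<^sup>2) w t - r * (A * b / 2 * ?W + B * c * F')
       + B * (a + 1) * (r * ?W) + (A * c\<^sup>2 / 2 - e) * (r\<^sup>2 * ?G)
       + r\<^sup>2 * (B * e\<^sup>2) * (r * ?G) - B * c / (8 * \<kappa>) * (r * ?G)"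
    using pos by (simp add: field_simps power2_eq_square)
  also have "\<dots> \<le> energy A B D (F - e * r\<^sup>2 / 2 * (norm G)\<^sup>2) w t - r * (A * b / 4 * ?W + B * c * F')"
    using 10 11 12 by (simp add: algebra_simps)
  finally show ?thesis .
qed


text \<open>Everything is expanded at the old point, with \<open>a\<close> and \<open>p\<close> the
  coefficients obtained after inserting the velocity update. The first-order cross terms cancel as
  before, \<open>p\<close> covers the gradient square coming from \<open>v'\<close>, and strong
  convexity in \<open>coercive\<close> supplies dissipation in \<open>(norm u)\<^sup>2\<close>,
  which together with that of \<open>v\<close> absorbs all errors once \<open>r * \<kappa>\<close>
  is small.\<close>

lemma unaccelerated_step:
  fixes u v G d :: "'a::real_inner"
  assumes d: "d = (a * r) *\<^sub>R v - (p * r\<^sup>2) *\<^sub>R G"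
    and v': "v' = (1 - b * r) *\<^sub>R v - (c * r) *\<^sub>R G"
    and descent: "F' \<le> F + inner G d + \<kappa> * (norm d)\<^sup>2"
    and coercive: "F + (norm u)\<^sup>2 / 2 \<le> inner G u"
    and G: "norm G \<le> \<kappa> * norm u"
    and F: "0 \<le> F"
    and A: "A * (1 - b * r) * c = a" and D: "D * a = B * b" and p: "A * c\<^sup>2 / 2 \<le> p"
    and pos: "0 < r" "0 \<le> A" "0 \<le> B" "0 \<le> D" "0 \<le> a" "0 \<le> b" "b * r \<le> 1" "0 \<le> c" "0 \<le> p" "1 \<le> \<kappa>"
    and M: "b \<le> M" "c \<le> M" and P: "a \<le> P" "p \<le> P"
    and step: "r * \<kappa> \<le> 1" "r * \<kappa> * (P\<^sup>2 + D / 2 * P\<^sup>2 + B * P + B * (M * P)) \<le> B * c / 8"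
      "r * \<kappa> * (P\<^sup>2 + D / 2 * P\<^sup>2 + B * P + B * (M * P)) \<le> A * b / 16"
    and B: "B * a \<le> A * b / 4"
  shows "energy A B D F' v' (u + d) \<le> energy A B D F v u - r * (A * b / 8 * (norm v)\<^sup>2 + B * c * F)"
proof -
  \<comment> \<open>Each second-order error will be \<open>r * \<epsilon> * n\<^sup>2\<close> times
    a constant; the four summands of \<open>Q\<close> are these constants, in the order of
    \<open>e1\<close> to \<open>e4\<close>.\<close>
  define \<epsilon> where "\<epsilon> = r * \<kappa>"
  define n where "n = norm v + norm u"
  let ?V = "(norm v)\<^sup>2" and ?U = "(norm u)\<^sup>2" and ?G = "(norm G)\<^sup>2"
  define Q where "Q = P\<^sup>2 + D / 2 * P\<^sup>2 + B * P + B * (M * P)"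
  have n: "0 \<le> n" "norm v \<le> n" "norm u \<le> n" by (auto simp: n_def)
  have eps: "0 \<le> \<epsilon>" "r \<le> \<epsilon>" "\<epsilon> \<le> 1"
    using pos step(1) by (auto simp: \<epsilon>_def)
  have P0: "0 \<le> P" "0 \<le> M" using P M pos by auto
  have rG: "r * norm G \<le> \<epsilon> * norm u"
    using G pos by (simp add: \<epsilon>_def mult.assoc)
  \<comment> \<open>\<open>r * norm G\<close> is at most \<open>\<epsilon> * norm u\<close>, hence
    at most \<open>norm u\<close>, so the gradient part of \<open>d\<close> is, like the velocity
    part, of order \<open>r\<close> with no factor \<open>\<kappa>\<close>.\<close>
  have nd: "norm d \<le> r * P * n"
  proof -
    have "norm d \<le> a * r * norm v + p * r * (r * norm G)"
      unfolding d using pos norm_triangle_ineq4[of "(a * r) *\<^sub>R v" "(p * r\<^sup>2) *\<^sub>R G"]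
      by (simp add: power2_eq_square mult_ac)
    also have "\<dots> \<le> P * r * norm v + P * r * norm u"
    proof -
      have "r * norm G \<le> norm u"
        using rG eps mult_right_mono[of \<epsilon> 1 "norm u"] by simp
      then show ?thesis
        using pos P P0 by (intro add_mono mult_mono) auto
    qed
    finally show ?thesis by (simp add: n_def algebra_simps)
  qed
  have nv: "norm (b *\<^sub>R v + c *\<^sub>R G) * r \<le> M * \<epsilon> * n"
  proof -
    have "norm (b *\<^sub>R v + c *\<^sub>R G) * r \<le> (b * norm v + c * norm G) * r"
      using pos norm_triangle_ineq[of "b *\<^sub>R v" "c *\<^sub>R G"] by (intro mult_right_mono) auto
    also have "\<dots> = b * (r * norm v) + c * (r * norm G)" by (simp add: algebra_simps)
    also have "\<dots> \<le> M * (\<epsilon> * norm v) + M * (\<epsilon> * norm u)"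
      using pos M P0 rG eps by (intro add_mono mult_mono[OF _ mult_right_mono] mult_mono[OF _ rG]) auto
    finally show ?thesis by (simp add: n_def algebra_simps)
  qed
  have nd2: "(norm d)\<^sup>2 \<le> r\<^sup>2 * P\<^sup>2 * n\<^sup>2"
    using power_mono[OF nd norm_ge_zero, of 2] by (simp add: power_mult_distrib)
  have e1: "\<kappa> * (norm d)\<^sup>2 \<le> r * \<epsilon> * n\<^sup>2 * P\<^sup>2"
    using mult_left_mono[OF nd2, of \<kappa>] pos by (simp add: \<epsilon>_def power2_eq_square mult_ac)
  have e2: "D / 2 * (norm d)\<^sup>2 \<le> r * \<epsilon> * n\<^sup>2 * (D / 2 * P\<^sup>2)"
  proof -
    have "D / 2 * (norm d)\<^sup>2 \<le> D / 2 * (r\<^sup>2 * P\<^sup>2 * n\<^sup>2)"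
      using nd2 pos by (intro mult_left_mono) auto
    also have "\<dots> = r * r * (n\<^sup>2 * (D / 2 * P\<^sup>2))"
      by (simp add: power2_eq_square mult_ac)
    also have "\<dots> \<le> r * \<epsilon> * (n\<^sup>2 * (D / 2 * P\<^sup>2))"
      using eps pos by (intro mult_right_mono mult_left_mono) auto
    finally show ?thesis by (simp add: mult_ac)
  qed
  have e3: "- (B * p * r\<^sup>2 * inner v G) \<le> r * \<epsilon> * n\<^sup>2 * (B * P)"
  proof -
    have "- inner v G * r \<le> norm v * norm G * r"
      using Cauchy_Schwarz_ineq2[of v G] pos by (intro mult_right_mono) auto
    also have "\<dots> = norm v * (r * norm G)" by simp
    also have "\<dots> \<le> n * (\<epsilon> * n)"
      using n pos by (intro mult_mono order.trans[OF rG mult_left_mono[OF n(3) eps(1)]]) auto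
    finally have "p * (- inner v G * r) \<le> p * (n * (\<epsilon> * n))"
      using pos by (intro mult_left_mono) auto
    also have "\<dots> \<le> P * (n * (\<epsilon> * n))"
      using P n eps by (intro mult_right_mono) auto
    finally have "B * r * (p * (- inner v G * r)) \<le> B * r * (P * (n * (\<epsilon> * n)))"
      using pos by (intro mult_left_mono) auto
    then show ?thesis by (simp add: power2_eq_square mult_ac)
  qed
  have e4: "B * inner (v' - v) d \<le> r * \<epsilon> * n\<^sup>2 * (B * (M * P))"
  proof -
    have "v' - v = - (r *\<^sub>R (b *\<^sub>R v + c *\<^sub>R G))"
      by (simp add: v' algebra_simps)
    then have "inner (v' - v) d \<le> norm (b *\<^sub>R v + c *\<^sub>R G) * r * norm d"
      using norm_cauchy_schwarz[of "v' - v" d] pos by (simp add: mult_ac)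
    also have "\<dots> \<le> M * \<epsilon> * n * (r * P * n)"
      using P0 eps n by (intro mult_mono[OF nv nd]) auto
    finally have "B * inner (v' - v) d \<le> B * (M * \<epsilon> * n * (r * P * n))"
      using pos by (intro mult_left_mono) auto
    then show ?thesis by (simp add: power2_eq_square mult_ac)
  qed
  have n2: "n\<^sup>2 \<le> 2 * (?V + ?U)"
    using sum_squares_bound[of "norm v" "norm u"] by (simp add: n_def power2_sum)
  have Q: "0 \<le> Q" unfolding Q_def using pos P0 by (intro add_nonneg_nonneg) auto
  have "r * \<epsilon> * n\<^sup>2 * Q = r * (\<epsilon> * Q) * n\<^sup>2" by (simp only: mult_ac)
  also have "\<dots> \<le> r * (\<epsilon> * Q) * (2 * (?V + ?U))"
    using n2 pos eps Q by (intro mult_left_mono) auto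
  also have "\<dots> = 2 * r * ((\<epsilon> * Q) * ?V + (\<epsilon> * Q) * ?U)" by (simp add: algebra_simps)
  also have "\<dots> \<le> 2 * r * (A * b / 16 * ?V + B * c / 8 * ?U)"
    using step pos unfolding \<epsilon>_def Q_def by (intro mult_left_mono add_mono mult_right_mono) auto
  also have "\<dots> = r * (A * b / 8 * ?V + B * c / 4 * ?U)"
    by (simp add: field_simps)
  finally have err: "r * \<epsilon> * n\<^sup>2 * Q \<le> r * (A * b / 8 * ?V + B * c / 4 * ?U)" .
  have sw: "inner G v = inner v G" "inner u v = inner v u" "inner u G = inner G u"
    by (simp_all add: inner_commute)
  note expand = power2_norm_eq_inner inner_simps sw
  have "A / 2 * (norm v')\<^sup>2 = A / 2 * ?V - A / 2 * (b * r) * (2 - b * r) * ?V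
      - a * r * inner v G + A * c\<^sup>2 / 2 * r\<^sup>2 * ?G"
    unfolding v' A[symmetric] by (simp add: expand) (simp add: field_simps power2_eq_square)
  moreover have "A / 2 * (b * r) * ?V \<le> A / 2 * (b * r) * (2 - b * r) * ?V"
  proof -
    have "A / 2 * (b * r) * 1 \<le> A / 2 * (b * r) * (2 - b * r)"
      using pos by (intro mult_left_mono) auto
    then show ?thesis by (intro mult_right_mono) auto
  qed
  moreover have "A * c\<^sup>2 / 2 * (r\<^sup>2 * ?G) \<le> p * (r\<^sup>2 * ?G)"
    using p by (intro mult_right_mono) auto
  ultimately have 1: "A / 2 * (norm v')\<^sup>2 \<le> A / 2 * ?V - A / 2 * (b * r) * ?V
      - a * r * inner v G + p * r\<^sup>2 * ?G"
    by (simp only: mult.assoc)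
  have 2: "B * inner v' (u + d) = B * inner v u - B * b * r * inner v u - B * c * r * inner G u
      + B * a * (r * ?V) - B * p * r\<^sup>2 * inner v G + B * inner (v' - v) d"
  proof -
    have "inner (v' - v) u = - b * r * inner v u - c * r * inner G u"
      unfolding v' by (simp add: expand algebra_simps)
    moreover have "inner v d = a * (r * ?V) - p * r\<^sup>2 * inner v G"
      unfolding d by (simp add: expand)
    moreover have "inner v' (u + d) = inner v u + inner (v' - v) u + inner v d + inner (v' - v) d"
      by (simp add: inner_simps)
    ultimately have *: "inner v' (u + d) = inner v u + (- b * r * inner v u - c * r * inner G u)
        + (a * (r * ?V) - p * r\<^sup>2 * inner v G) + inner (v' - v) d"
      by linarith
    show ?thesis unfolding * by (simp add: algebra_simps)
  qed
  have "D / 2 * (norm (u + d))\<^sup>2 = D / 2 * ?U + D * a * r * inner v u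
      - D * p * r\<^sup>2 * inner G u + D / 2 * (norm d)\<^sup>2"
  proof -
    have "inner d u = a * r * inner v u - p * r\<^sup>2 * inner G u"
      unfolding d by (simp add: expand)
    moreover have "(norm (u + d))\<^sup>2 = ?U + 2 * inner d u + (norm d)\<^sup>2"
      by (simp add: power2_norm_eq_inner inner_simps inner_commute[of u d])
    ultimately have *: "(norm (u + d))\<^sup>2
        = ?U + 2 * (a * r * inner v u - p * r\<^sup>2 * inner G u) + (norm d)\<^sup>2"
      by (simp only:)
    show ?thesis unfolding * by (simp add: algebra_simps)
  qed
  moreover have "0 \<le> inner G u"
    using F by (intro order.trans[OF _ coercive]) simp
  then have "0 \<le> D * p * r\<^sup>2 * inner G u" using pos by simp
  ultimately have 3: "D / 2 * (norm (u + d))\<^sup>2 \<le> D / 2 * ?U + B * b * r * inner v u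
      + D / 2 * (norm d)\<^sup>2"
    using D by simp
  have 4: "inner G d = a * r * inner v G - p * r\<^sup>2 * ?G"
    unfolding d by (simp add: expand)
  have 5: "B * c * r * (F + ?U / 2) \<le> B * c * r * inner G u"
    using coercive pos by (intro mult_left_mono) auto
  have 6: "B * a * (r * ?V) \<le> A * b / 4 * (r * ?V)"
    using B pos by (intro mult_right_mono) auto
  define X where "X = r * \<epsilon> * n\<^sup>2 * Q"
  have X: "X = r * \<epsilon> * n\<^sup>2 * P\<^sup>2 + r * \<epsilon> * n\<^sup>2 * (D / 2 * P\<^sup>2)
      + r * \<epsilon> * n\<^sup>2 * (B * P) + r * \<epsilon> * n\<^sup>2 * (B * (M * P))"
    unfolding X_def Q_def by (simp only: distrib_left)
  \<comment> \<open>Of the dissipation \<open>A * b / 2\<close> in \<open>?V\<close>, one half goes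
    to fact \<open>6\<close> and a quarter to \<open>X\<close>; of \<open>B * c / 2\<close> in
    \<open>?U\<close>, one half goes to \<open>X\<close>.\<close>
  have "energy A B D F' v' (u + d) \<le> energy A B D F v u - A / 2 * (b * r) * ?V
      - B * c * r * (F + ?U / 2) + B * a * (r * ?V) + X"
    unfolding energy_def using 1 2 3 descent[unfolded 4] 5 e1 e2 e3 e4 X by linarith
  also have "\<dots> \<le> energy A B D F v u - r * (A * b / 8 * ?V + B * c * F)
      - r * B * c / 4 * ?U"
    using 6 err[folded X_def] by (simp add: algebra_simps)
  also have "\<dots> \<le> energy A B D F v u - r * (A * b / 8 * ?V + B * c * F)"
    using pos by simp
  finally show ?thesis .
qed

text \<open>\<open>accelerated_step\<close> dissipates the old velocity and the new function value,
  so the new energy has to be bounded by exactly these two; the new velocity is therefore written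
  out in terms of \<open>w\<close> and \<open>G\<close>. All powers of \<open>M\<close> are raised
  to \<open>M ^ 4\<close>, and \<open>20\<close> is generous.\<close>

lemma energy_le_accelerated:
  fixes w G u :: "'a::real_inner"
  assumes "1 \<le> M" "0 \<le> A" "A \<le> 2 * M\<^sup>2" "0 \<le> B" "B \<le> 1" "D \<le> M\<^sup>2"
    and "0 \<le> b * r" "b * r \<le> 1" "0 \<le> c" "c \<le> M" "0 \<le> e" "e \<le> M" "0 \<le> r" "r \<le> 1"
    and F: "r\<^sup>2 * (norm G)\<^sup>2 \<le> F" "(norm u)\<^sup>2 / 2 \<le> F"
  shows "energy A B D (F - e * r\<^sup>2 / 2 * (norm G)\<^sup>2) ((1 - b * r) *\<^sub>R w - (c * r) *\<^sub>R G) (u - (e * r\<^sup>2) *\<^sub>R G)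
    \<le> 20 * M ^ 4 * ((norm w)\<^sup>2 + F)"
proof -
  let ?w = "(1 - b * r) *\<^sub>R w - (c * r) *\<^sub>R G" and ?t = "u - (e * r\<^sup>2) *\<^sub>R G"
  have F0: "0 \<le> F" by (rule order.trans[OF _ F(2)]) simp
  have M2: "1 \<le> M\<^sup>2" "M\<^sup>2 \<le> M ^ 4" "1 \<le> M ^ 4"
    using assms(1) by (auto intro: power_increasing)
  have "(norm ?w)\<^sup>2 \<le> 2 * (norm ((1 - b * r) *\<^sub>R w))\<^sup>2 + 2 * (norm ((c * r) *\<^sub>R G))\<^sup>2"
    using norm_add_square_le[of "(1 - b * r) *\<^sub>R w" "- ((c * r) *\<^sub>R G)"] by simp
  also have "\<dots> = 2 * ((1 - b * r)\<^sup>2 * (norm w)\<^sup>2) + 2 * (c\<^sup>2 * (r\<^sup>2 * (norm G)\<^sup>2))"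
    by (simp add: power_mult_distrib)
  also have "\<dots> \<le> 2 * (1 * (norm w)\<^sup>2) + 2 * (M\<^sup>2 * F)"
    using assms F by (intro add_mono mult_left_mono mult_mono power_mono power_le_one) auto
  finally have w: "(norm ?w)\<^sup>2 \<le> 2 * (norm w)\<^sup>2 + 2 * M\<^sup>2 * F" by simp
  have r2: "r\<^sup>2 \<le> 1" using assms by (intro power_le_one) auto
  have "(norm ?t)\<^sup>2 \<le> 2 * (norm u)\<^sup>2 + 2 * (norm ((e * r\<^sup>2) *\<^sub>R G))\<^sup>2"
    using norm_add_square_le[of u "- ((e * r\<^sup>2) *\<^sub>R G)"] by simp
  also have "\<dots> = 2 * (norm u)\<^sup>2 + 2 * (e\<^sup>2 * (r\<^sup>2 * (r\<^sup>2 * (norm G)\<^sup>2)))"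
    by (simp add: power_mult_distrib power2_eq_square)
  also have "\<dots> \<le> 2 * (2 * F) + 2 * (M\<^sup>2 * (1 * F))"
    using assms F r2 F0 by (intro add_mono mult_left_mono mult_mono power_mono) auto
  finally have t: "(norm ?t)\<^sup>2 \<le> 4 * F + 2 * M\<^sup>2 * F" by simp
  have "energy A B D (F - e * r\<^sup>2 / 2 * (norm G)\<^sup>2) ?w ?t
     \<le> F - e * r\<^sup>2 / 2 * (norm G)\<^sup>2 + (A + B) / 2 * (norm ?w)\<^sup>2 + (B + D) / 2 * (norm ?t)\<^sup>2"
    using assms by (intro energy_le)
  also have "\<dots> \<le> F + 2 * M\<^sup>2 * (norm ?w)\<^sup>2 + M\<^sup>2 * (norm ?t)\<^sup>2"
  proof -
    have coeffs: "(A + B) / 2 \<le> 2 * M\<^sup>2" "(B + D) / 2 \<le> M\<^sup>2"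
      using assms(3,5,6) M2(1) by (simp_all add: field_simps del: one_le_power)
    have "(A + B) / 2 * (norm ?w)\<^sup>2 \<le> 2 * M\<^sup>2 * (norm ?w)\<^sup>2"
      using coeffs(1) by (rule mult_right_mono) simp
    moreover have "(B + D) / 2 * (norm ?t)\<^sup>2 \<le> M\<^sup>2 * (norm ?t)\<^sup>2"
      using coeffs(2) by (rule mult_right_mono) simp
    moreover have "0 \<le> e * r\<^sup>2 / 2 * (norm G)\<^sup>2" using assms by simp
    ultimately show ?thesis by linarith
  qed
  also have "\<dots> \<le> F + 2 * M\<^sup>2 * (2 * (norm w)\<^sup>2 + 2 * M\<^sup>2 * F) + M\<^sup>2 * (4 * F + 2 * M\<^sup>2 * F)"
    using w t by (intro add_mono mult_left_mono order.refl) auto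
  also have "\<dots> = F + 4 * M\<^sup>2 * (norm w)\<^sup>2 + 6 * M ^ 4 * F + 4 * M\<^sup>2 * F"
    by (simp add: algebra_simps power2_eq_square power4_eq_xxxx)
  also have "\<dots> \<le> M ^ 4 * F + 4 * M ^ 4 * (norm w)\<^sup>2 + 6 * M ^ 4 * F + 4 * M ^ 4 * F"
    using M2 F0 mult_right_mono[OF M2(3) F0] by (intro add_mono mult_right_mono) auto
  also have "\<dots> \<le> 20 * M ^ 4 * ((norm w)\<^sup>2 + F)"
    using M2 F0 by (simp add: algebra_simps)
  finally show ?thesis .
qed

section \<open>Geometric decay from the one-step estimates\<close>

lemma geometric_decay:
  fixes E :: "nat \<Rightarrow> real"
  assumes "\<And>k. E (Suc k) \<le> q * E k" "0 \<le> q"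
  shows "E k \<le> q ^ k * E 0"
proof (induction k)
  case (Suc k)
  have "E (Suc k) \<le> q * E k" by (rule assms)
  also have "\<dots> \<le> q * (q ^ k * E 0)" using Suc assms by (intro mult_left_mono)
  finally show ?case by (simp add: mult.assoc)
qed simp

text \<open>\<open>w k\<close> is the velocity at step \<open>k + 1\<close>; since the velocity
  starts at zero, \<open>w 0\<close> is a multiple of \<open>G 0\<close>. All constants come out as
  powers of \<open>M\<close>, the common bound for the coefficients and for the reciprocals of
  \<open>a\<close>, \<open>b\<close>, \<open>c\<close>.\<close>

lemma accelerated_rate:
  fixes u w G :: "nat \<Rightarrow> 'a::real_inner"
  assumes u: "\<And>k. u (Suc k) = u k + (a * r) *\<^sub>R w k - (e * r\<^sup>2) *\<^sub>R G k"
    and w: "\<And>k. w (Suc k) = (1 - b * r) *\<^sub>R w k - (c * r) *\<^sub>R G (Suc k)"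
    and w0: "w 0 = - ((c * r) *\<^sub>R G 0)"
    and convex: "\<And>k. F (Suc k) \<le> F k + inner (G (Suc k)) (u (Suc k) - u k)
      - (norm (G (Suc k) - G k))\<^sup>2 / (4 * \<kappa>)"
    and coercive: "\<And>k. F k + (norm (G k))\<^sup>2 / (4 * \<kappa>) \<le> inner (G k) (u k)"
    and F: "\<And>k. (norm (G k))\<^sup>2 / (4 * \<kappa>) \<le> F k" "\<And>k. (norm (u k))\<^sup>2 / 2 \<le> F k"
    and M: "1 \<le> M" "1 / M \<le> a" "a \<le> M" "1 / M \<le> b" "b \<le> M" "1 / M \<le> c" "c \<le> M" "0 \<le> e" "e \<le> M"
    and r: "0 < r" "r \<le> 1" "b * r \<le> 1 / 2" and \<kappa>: "0 < \<kappa>"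
    and K: "0 \<le> K" "a * c / (2 * (1 - b * r)) - e \<le> K * r"
    and small: "\<kappa> * r\<^sup>2 * (64 * M ^ 5 * (K + 1)) \<le> 1"
  shows "F k \<le> 40 * M ^ 4 * F 0 * (1 - 1 / (320 * M ^ 9) * r) ^ k"
proof -
  have "0 < M" "0 < 1 / M" using M(1) by simp_all
  then have pos: "0 < a" "0 < b" "0 < c" "0 < M"
    using M by linarith+
  have br: "1 / 2 \<le> 1 - b * r" "1 - b * r \<le> 1" "0 \<le> b * r" using r pos by auto
  \<comment> \<open>\<open>A\<close> and \<open>D\<close> are forced by the two cancellations of
    \<open>accelerated_step\<close>. \<open>B\<close> is tuned so that
    \<open>B * (a + 1) \<le> B * (2 * M) = 1 / (4 * M ^ 3)\<close>, a quarter of the lower bound of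
    \<open>A * b\<close>.\<close>
  define A where "A = a / (c * (1 - b * r))"
  define B where "B = 1 / (8 * M ^ 4)"
  define D where "D = B * b / a"
  define E where "E k = energy A B D (F k - e * r\<^sup>2 / 2 * (norm (G k))\<^sup>2) (w k) (u k - (e * r\<^sup>2) *\<^sub>R G k)" for k
  \<comment> \<open>The dissipation constant \<open>1 / (8 * M ^ 5)\<close> divided by the constant
    \<open>20 * M ^ 4\<close> of \<open>energy_le_accelerated\<close>.\<close>
  define \<sigma> where "\<sigma> = 1 / (160 * M ^ 9)"
  have Mp: "1 \<le> M ^ i" for i using M by simp
  have B: "0 < B" "B \<le> 1" "B * M\<^sup>2 \<le> 1"
    using pos M Mp[of 4] Mp[of 2] by (auto simp: B_def field_simps power2_eq_square power4_eq_xxxx)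
  have A1: "1 / M\<^sup>2 \<le> A"
  proof -
    have "1 / M\<^sup>2 = (1 / M) / (M * 1)" by (simp add: power2_eq_square)
    also have "\<dots> \<le> a / (c * (1 - b * r))"
      using M pos br by (intro frac_le mult_mono mult_pos_pos) auto
    finally show ?thesis by (simp add: A_def)
  qed
  have A2: "A \<le> 2 * M\<^sup>2"
  proof -
    have "a / (c * (1 - b * r)) \<le> M / (1 / M * (1 / 2))"
      using M pos br by (intro frac_le mult_mono mult_pos_pos) auto
    then show ?thesis by (simp add: A_def power2_eq_square)
  qed
  have A0: "0 < A" using pos by (intro less_le_trans[OF _ A1]) simp
  have D0: "0 \<le> D" using B pos by (simp add: D_def)
  have D2: "D \<le> M\<^sup>2"
  proof -
    have "B * b / a \<le> 1 * M / (1 / M)"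
      using B pos M by (intro frac_le mult_mono) auto
    then show ?thesis by (simp add: D_def power2_eq_square)
  qed
  have Ab: "1 / M ^ 3 \<le> A * b"
  proof -
    have "1 / M ^ 3 = 1 / M\<^sup>2 * (1 / M)" by (simp add: power2_eq_square power3_eq_cube)
    also have "\<dots> \<le> A * b" using A1 M A0 pos by (intro mult_mono) auto
    finally show ?thesis .
  qed
  have Bc: "1 / (8 * M ^ 5) \<le> B * c"
  proof -
    have "1 / (8 * M ^ 5) = B * (1 / M)" using pos by (simp add: B_def field_simps eval_nat_numeral)
    also have "\<dots> \<le> B * c" using B M by (intro mult_left_mono) auto
    finally show ?thesis .
  qed
  have BA: "B * (a + 1) \<le> A * b / 4"
  proof -
    have "B * (a + 1) \<le> B * (2 * M)" using B M by (intro mult_left_mono) auto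
    also have "\<dots> = 1 / M ^ 3 / 4" using pos by (simp add: B_def field_simps eval_nat_numeral)
    finally show ?thesis using Ab by simp
  qed
  have BAD: "B\<^sup>2 \<le> A * D"
  proof -
    have "B * a \<le> A * b" using BA B(1) mult_pos_pos[OF A0 pos(2)] by (simp add: distrib_left)
    then have "B * (B * a) \<le> B * (A * b)" using B by (intro mult_left_mono) auto
    then show ?thesis using pos by (simp add: D_def field_simps power2_eq_square)
  qed
  have kr: "\<kappa> * r\<^sup>2 * (64 * M ^ 5) \<le> 1"
  proof -
    have "\<kappa> * r\<^sup>2 * (64 * M ^ 5 * 1) \<le> \<kappa> * r\<^sup>2 * (64 * M ^ 5 * (K + 1))"
      using \<kappa> K pos by (intro mult_left_mono) auto
    then show ?thesis using small by linarith
  qed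
  have kM: "8 * M * (\<kappa> * r\<^sup>2) \<le> 1"
  proof -
    have "8 * M * (\<kappa> * r\<^sup>2) \<le> 64 * M ^ 5 * (\<kappa> * r\<^sup>2)"
      using M \<kappa> power_increasing[of 1 5 M] by (intro mult_right_mono mult_mono) auto
    then show ?thesis using kr by (simp add: mult_ac)
  qed
  have ke: "8 * e * (\<kappa> * r\<^sup>2) \<le> 1"
    by (rule order.trans[OF mult_right_mono kM]) (use \<kappa> M in auto)
  have k1: "8 * (\<kappa> * r\<^sup>2) \<le> 1"
    by (rule order.trans[OF mult_right_mono kM]) (use \<kappa> M in auto)
  have G4: "(norm (G k))\<^sup>2 \<le> 4 * \<kappa> * F k" for k
    using F(1)[of k] \<kappa> by (simp add: field_simps)
  have F0: "0 \<le> F k" for k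
    by (rule order.trans[OF _ F(2)]) simp
  have rG: "r\<^sup>2 * (norm (G k))\<^sup>2 \<le> F k" for k
  proof -
    have "r\<^sup>2 * (norm (G k))\<^sup>2 \<le> r\<^sup>2 * (4 * \<kappa> * F k)"
      using G4 by (intro mult_left_mono) auto
    also have "\<dots> = (4 * (\<kappa> * r\<^sup>2)) * F k" by (simp add: mult_ac)
    also have "\<dots> \<le> 1 * F k" using k1 F0 \<kappa> by (intro mult_right_mono) auto
    finally show ?thesis by simp
  qed
  \<comment> \<open>The correction subtracted from the function value is at most
    \<open>F k / 4\<close>, so the energy still controls \<open>F k\<close>; the factor 2 lost here
    turns \<open>20\<close> into \<open>40\<close>.\<close>
  have half: "F k / 2 \<le> F k - e * r\<^sup>2 / 2 * (norm (G k))\<^sup>2" for k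
  proof -
    have "e * r\<^sup>2 / 2 * (norm (G k))\<^sup>2 \<le> e * r\<^sup>2 / 2 * (4 * \<kappa> * F k)"
      using G4 M by (intro mult_left_mono) auto
    also have "\<dots> = (8 * e * (\<kappa> * r\<^sup>2)) * (F k / 4)" by simp
    also have "\<dots> \<le> 1 * (F k / 4)" using ke F0 by (intro mult_right_mono) auto
    finally show ?thesis using F0[of k] by simp
  qed
  have step2: "\<kappa> * r\<^sup>2 * (K + B * e\<^sup>2) \<le> B * c / 8"
  proof -
    have "B * e\<^sup>2 \<le> 1"
      using B M by (intro order.trans[OF mult_left_mono B(3)] power_mono) auto
    then have "\<kappa> * r\<^sup>2 * (K + B * e\<^sup>2) \<le> \<kappa> * r\<^sup>2 * (K + 1)"
      using B \<kappa> by (intro mult_left_mono) auto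
    also have "\<dots> \<le> 1 / (64 * M ^ 5)"
      using small pos by (simp add: field_simps)
    also have "\<dots> \<le> B * c / 8" using Bc by simp
    finally show ?thesis .
  qed
  have Eub: "E k \<le> 20 * M ^ 4 * ((norm w')\<^sup>2 + F k)"
    if "w k = (1 - b * r) *\<^sub>R w' - (c * r) *\<^sub>R G k" for k w'
    unfolding E_def that
    using M A0 A2 B D2 br r pos rG F(2) by (intro energy_le_accelerated) auto
  have Estep: "E (Suc k) \<le> E k - r * (1 / (8 * M ^ 5) * ((norm (w k))\<^sup>2 + F (Suc k)))" for k
  proof -
    have "E (Suc k) \<le> E k - r * (A * b / 4 * (norm (w k))\<^sup>2 + B * c * F (Suc k))"
      unfolding E_def
    proof (rule accelerated_step)
      show "u (Suc k) - (e * r\<^sup>2) *\<^sub>R G (Suc k)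
        = u k - (e * r\<^sup>2) *\<^sub>R G k + (a * r) *\<^sub>R w k - (e * r\<^sup>2) *\<^sub>R G (Suc k)"
        by (simp add: u)
      show "w (Suc k) = (1 - b * r) *\<^sub>R w k - (c * r) *\<^sub>R G (Suc k)" by (rule w)
      show "F (Suc k) \<le> F k + inner (G (Suc k)) ((a * r) *\<^sub>R w k - (e * r\<^sup>2) *\<^sub>R G k)
          - (norm (G (Suc k) - G k))\<^sup>2 / (4 * \<kappa>)"
        using convex[of k] by (simp add: u algebra_simps)
      show "F (Suc k) + (norm (G (Suc k)))\<^sup>2 / (4 * \<kappa>)
          \<le> inner (G (Suc k)) (u (Suc k) - (e * r\<^sup>2) *\<^sub>R G (Suc k) + (e * r\<^sup>2) *\<^sub>R G (Suc k))"
        using coercive[of "Suc k"] by simp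
      show "A * (1 - b * r) * c = a" using pos br by (simp add: A_def)
      show "D * a = B * b" using pos by (simp add: D_def)
      show "A * c\<^sup>2 / 2 - e \<le> K * r"
        using K(2) pos br by (simp add: A_def power2_eq_square mult.commute)
    qed (use F0 A0 B D0 pos r \<kappa> M ke step2 BA in auto)
    also have "\<dots> \<le> E k - r * (1 / (8 * M ^ 5) * (norm (w k))\<^sup>2 + 1 / (8 * M ^ 5) * F (Suc k))"
    proof -
      have "4 * M ^ 3 \<le> 8 * M ^ 5"
        using M pos by (intro mult_mono power_increasing) auto
      then have "1 / (8 * M ^ 5) \<le> 1 / (4 * M ^ 3)"
        using pos by (intro frac_le) auto
      then have "1 / (8 * M ^ 5) \<le> 1 / M ^ 3 / 4" by (simp add: mult.commute)
      also have "\<dots> \<le> A * b / 4" using Ab by (rule divide_right_mono) simp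
      finally have "1 / (8 * M ^ 5) \<le> A * b / 4" .
      then show ?thesis
        using Bc F0 r by (intro diff_left_mono mult_left_mono add_mono mult_right_mono) auto
    qed
    finally show ?thesis by (simp add: distrib_left)
  qed
  have Edecay: "E (Suc k) \<le> (1 - \<sigma> / 2 * r) * E k" and "0 \<le> 1 - \<sigma> / 2 * r" for k
  proof -
    have \<sigma>: "0 < \<sigma>" "\<sigma> \<le> 1" using pos Mp[of 9] by (auto simp: \<sigma>_def field_simps)
    then have \<sigma>r: "0 \<le> \<sigma> * r" "\<sigma> * r \<le> 1" using r by (auto intro: mult_le_one)
    then show nn: "0 \<le> 1 - \<sigma> / 2 * r" by simp
    have "\<sigma> * E (Suc k) \<le> \<sigma> * (20 * M ^ 4 * ((norm (w k))\<^sup>2 + F (Suc k)))"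
      using \<sigma> Eub[OF w] by (intro mult_left_mono) auto
    also have "\<dots> = 1 / (8 * M ^ 5) * ((norm (w k))\<^sup>2 + F (Suc k))"
      using pos by (simp add: \<sigma>_def field_simps eval_nat_numeral)
    finally have "r * (\<sigma> * E (Suc k)) \<le> r * (1 / (8 * M ^ 5) * ((norm (w k))\<^sup>2 + F (Suc k)))"
      using r by (intro mult_left_mono) auto
    then have "(1 + \<sigma> * r) * E (Suc k) \<le> E k"
      using Estep[of k] by (simp add: algebra_simps)
    \<comment> \<open>The dissipation bounds the new energy, which gives the implicit factor
      \<open>1 / (1 + \<sigma> * r)\<close>. Since
      \<open>(1 - \<sigma> / 2 * r) * (1 + \<sigma> * r)\<close> is at least 1 for
      \<open>\<sigma> * r \<le> 1\<close>, it can be replaced by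
      \<open>1 - \<sigma> / 2 * r\<close>.\<close>
    then have "(1 - \<sigma> / 2 * r) * ((1 + \<sigma> * r) * E (Suc k)) \<le> (1 - \<sigma> / 2 * r) * E k"
      using nn by (rule mult_left_mono)
    moreover have "(1 - \<sigma> / 2 * r) * ((1 + \<sigma> * r) * E (Suc k))
      = E (Suc k) + (\<sigma> * r) * (1 - \<sigma> * r) / 2 * E (Suc k)"
      by (simp add: field_simps)
    moreover have "0 \<le> E (Suc k)"
    proof -
      have "0 \<le> F (Suc k) - e * r\<^sup>2 / 2 * (norm (G (Suc k)))\<^sup>2"
        using half[of "Suc k"] F0[of "Suc k"] by linarith
      also have "\<dots> \<le> E (Suc k)" unfolding E_def using A0 BAD by (rule energy_ge)
      finally show ?thesis .
    qed
    then have "0 \<le> (\<sigma> * r) * (1 - \<sigma> * r) / 2 * E (Suc k)"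
      using \<sigma> r \<sigma>r by (intro mult_nonneg_nonneg divide_nonneg_pos) auto
    ultimately show "E (Suc k) \<le> (1 - \<sigma> / 2 * r) * E k" by linarith
  qed
  have "F k / 2 \<le> F k - e * r\<^sup>2 / 2 * (norm (G k))\<^sup>2"
    by (rule half)
  also have "\<dots> \<le> E k" unfolding E_def using A0 BAD by (rule energy_ge)
  also have "\<dots> \<le> (1 - \<sigma> / 2 * r) ^ k * E 0"
    by (rule geometric_decay) fact+
  \<comment> \<open>\<open>w 0\<close> arises by one update from the velocity 0, so the bound of the
    initial energy contains \<open>F 0\<close> alone.\<close>
  also have "\<dots> \<le> (1 - \<sigma> / 2 * r) ^ k * (20 * M ^ 4 * F 0)"
    using Eub[of 0 0] w0 \<open>0 \<le> 1 - \<sigma> / 2 * r\<close> by (intro mult_left_mono) auto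
  finally show ?thesis by (simp add: \<sigma>_def mult_ac)
qed

text \<open>The velocity update is inserted into the position update, giving the coefficients
  \<open>a'\<close> and \<open>p\<close> of \<open>d\<close>. With \<open>A = a / c\<close> the
  velocity contributes a gradient square with coefficient \<open>a * c / 2\<close>, which
  \<open>p = a * c + e\<close> covers for every \<open>e \<ge> 0\<close>; the price is that
  \<open>r * \<kappa>\<close>, not just \<open>\<kappa> * r\<^sup>2\<close>, must be small.\<close>

lemma unaccelerated_rate:
  fixes u v G :: "nat \<Rightarrow> 'a::real_inner"
  assumes u: "\<And>k. u (Suc k) = u k + (a * r) *\<^sub>R v (Suc k) - (e * r\<^sup>2) *\<^sub>R G k"
    and v: "\<And>k. v (Suc k) = (1 - b * r) *\<^sub>R v k - (c * r) *\<^sub>R G k"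
    and v0: "v 0 = 0"
    and descent: "\<And>k. F (Suc k) \<le> F k + inner (G k) (u (Suc k) - u k) + \<kappa> * (norm (u (Suc k) - u k))\<^sup>2"
    and coercive: "\<And>k. F k + (norm (u k))\<^sup>2 / 2 \<le> inner (G k) (u k)"
    and G: "\<And>k. norm (G k) \<le> \<kappa> * norm (u k)"
    and F: "\<And>k. (norm (u k))\<^sup>2 / 2 \<le> F k"
    and M: "1 \<le> M" "1 / M \<le> a" "a \<le> M" "1 / M \<le> b" "b \<le> M" "1 / M \<le> c" "c \<le> M" "0 \<le> e" "e \<le> M"
    and r: "0 < r" "b * r \<le> 1 / 2" and \<kappa>: "1 \<le> \<kappa>"
    and small: "r * \<kappa> * (512 * M ^ 9) \<le> 1"
  shows "F k \<le> 3 * M\<^sup>2 * F 0 * (1 - 1 / (24 * M ^ 7) * r) ^ k"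
proof -
  have "0 < M" "0 < 1 / M" using M(1) by simp_all
  then have pos: "0 < a" "0 < b" "0 < c" "0 < M"
    using M by linarith+
  have br: "1 / 2 \<le> 1 - b * r" "1 - b * r \<le> 1" "0 \<le> b * r" using r pos by auto
  define a' where "a' = a * (1 - b * r)"
  define p where "p = a * c + e"
  define A where "A = a / c"
  define B where "B = 1 / (8 * M ^ 4)"
  define D where "D = B * b / a'"
  define E where "E k = energy A B D (F k) (v k) (u k)" for k
  \<comment> \<open>Bounds both \<open>a'\<close> and \<open>p\<close>, since \<open>a * c\<close>
    and \<open>e\<close> are each at most \<open>M\<^sup>2\<close>.\<close>
  define P where "P = 2 * M\<^sup>2"
  have Mp: "1 \<le> M ^ i" for i using M by simp
  have B: "0 < B" "B \<le> 1"
    using pos Mp[of 4] by (auto simp: B_def field_simps)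
  have a'0: "0 < a'" "1 / (2 * M) \<le> a'"
  proof -
    show "0 < a'" using pos br by (simp add: a'_def)
    have "1 / M * (1 / 2) \<le> a'"
      unfolding a'_def using M pos br by (intro mult_mono) auto
    then show "1 / (2 * M) \<le> a'" by simp
  qed
  have a'M: "a' \<le> M"
  proof -
    have "a' \<le> M * 1" unfolding a'_def using M pos br by (intro mult_mono) auto
    then show ?thesis by simp
  qed
  have A1: "1 / M\<^sup>2 \<le> A"
  proof -
    have "1 / M\<^sup>2 = (1 / M) / M" by (simp add: power2_eq_square)
    also have "\<dots> \<le> a / c" using M pos by (intro frac_le) auto
    finally show ?thesis by (simp add: A_def)
  qed
  have A2: "A \<le> M\<^sup>2"
  proof -
    have "a / c \<le> M / (1 / M)" using M pos by (intro frac_le) auto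
    then show ?thesis by (simp add: A_def power2_eq_square)
  qed
  have A0: "0 < A" using pos by (simp add: A_def)
  have D0: "0 \<le> D" using B pos a'0 by (simp add: D_def)
  have D1: "D \<le> 1"
  proof -
    have "D \<le> B * M / (1 / (2 * M))"
      unfolding D_def using B pos M a'0 by (intro frac_le mult_mono) auto
    also have "\<dots> = 1 / (4 * M\<^sup>2)"
      using pos by (simp add: B_def field_simps power2_eq_square power4_eq_xxxx)
    also have "\<dots> \<le> 1" using Mp[of 2] by (subst divide_le_eq_1) linarith
    finally show ?thesis .
  qed
  have Ab: "1 / M ^ 3 \<le> A * b"
  proof -
    have "1 / M ^ 3 = 1 / M\<^sup>2 * (1 / M)" by (simp add: power2_eq_square power3_eq_cube)
    also have "\<dots> \<le> A * b" using A1 M A0 pos by (intro mult_mono) auto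
    finally show ?thesis .
  qed
  have Bc: "1 / (8 * M ^ 5) \<le> B * c"
  proof -
    have "1 / (8 * M ^ 5) = B * (1 / M)" using pos by (simp add: B_def field_simps eval_nat_numeral)
    also have "\<dots> \<le> B * c" using B M by (intro mult_left_mono) auto
    finally show ?thesis .
  qed
  have le: "1 / (8 * M ^ 5) \<le> 1 / M ^ 3 / 8"
    using M pos power_increasing[of 3 5 M] by (simp add: field_simps)
  have BA: "B * a' \<le> A * b / 4"
  proof -
    have "B * a' \<le> B * M" using B a'M by (intro mult_left_mono) auto
    also have "\<dots> = 1 / M ^ 3 / 8" using pos by (simp add: B_def field_simps eval_nat_numeral)
    also have "\<dots> \<le> 1 / M ^ 3 / 4" using pos by (simp add: field_simps)
    finally show ?thesis using Ab by simp
  qed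
  have BAD: "B\<^sup>2 \<le> A * D"
  proof -
    have "B * a' \<le> A * b" using BA mult_pos_pos[OF A0 pos(2)] by simp
    then have "B * (B * a') \<le> B * (A * b)" using B by (intro mult_left_mono) auto
    then show ?thesis using a'0 by (simp add: D_def field_simps power2_eq_square)
  qed
  have P: "a' \<le> P" "p \<le> P"
  proof -
    have MM: "M \<le> M\<^sup>2" using M power_increasing[of 1 2 M] by simp
    then show "a' \<le> P" using a'M M by (simp add: P_def)
    have "a * c \<le> M * M" using M pos by (intro mult_mono) auto
    moreover have "e \<le> M * M" using MM M(9) by (simp add: power2_eq_square)
    ultimately show "p \<le> P" by (simp add: p_def P_def power2_eq_square)
  qed
  have Q: "P\<^sup>2 + D / 2 * P\<^sup>2 + B * P + B * (M * P) \<le> 8 * M ^ 4"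
  proof -
    have P2: "P\<^sup>2 = 4 * M ^ 4" by (simp add: P_def power_mult_distrib)
    have "D / 2 * P\<^sup>2 \<le> 1 / 2 * P\<^sup>2" using D1 by (intro mult_right_mono) auto
    moreover have "B * P = 1 / (4 * M\<^sup>2)" "B * (M * P) = 1 / (4 * M)"
      using pos by (simp_all add: B_def P_def field_simps eval_nat_numeral)
    moreover have "1 / (4 * M\<^sup>2) \<le> 1" by (subst divide_le_eq_1) (use Mp[of 2] in linarith)
    moreover have "1 / (4 * M) \<le> 1" using M(1) by simp
    ultimately have "P\<^sup>2 + D / 2 * P\<^sup>2 + B * P + B * (M * P) \<le> P\<^sup>2 + 1 / 2 * P\<^sup>2 + 1 + 1"
      by linarith
    also have "\<dots> \<le> 8 * M ^ 4" using Mp[of 4] unfolding P2 by simp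
    finally show ?thesis .
  qed
  \<comment> \<open>\<open>512 * M ^ 9\<close> in \<open>small\<close> is \<open>8 * M ^ 4\<close>,
    the bound of the error constant, times \<open>64 * M ^ 5\<close>, where
    \<open>1 / (64 * M ^ 5)\<close> is the lower bound of \<open>B * c / 8\<close>.\<close>
  have rQ: "r * \<kappa> * (P\<^sup>2 + D / 2 * P\<^sup>2 + B * P + B * (M * P)) \<le> 1 / (64 * M ^ 5)"
  proof -
    have "r * \<kappa> * (P\<^sup>2 + D / 2 * P\<^sup>2 + B * P + B * (M * P)) \<le> r * \<kappa> * (8 * M ^ 4)"
      using Q r \<kappa> by (intro mult_left_mono) auto
    also have "\<dots> \<le> 1 / (64 * M ^ 5)"
      using small pos by (simp add: field_simps eval_nat_numeral)
    finally show ?thesis .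
  qed
  have rk: "r * \<kappa> \<le> 1"
  proof -
    have "r * \<kappa> * 1 \<le> r * \<kappa> * (512 * M ^ 9)"
      using Mp[of 9] r \<kappa> by (intro mult_left_mono) auto
    then show ?thesis using small by simp
  qed
  have F0: "0 \<le> F k" for k
    by (rule order.trans[OF _ F]) simp
  have Eub: "E k \<le> 3 * M\<^sup>2 * ((norm (v k))\<^sup>2 + F k)" for k
  proof -
    have "E k \<le> F k + (A + B) / 2 * (norm (v k))\<^sup>2 + (B + D) / 2 * (norm (u k))\<^sup>2"
      unfolding E_def using B by (intro energy_le) auto
    also have "\<dots> \<le> F k + M\<^sup>2 * (norm (v k))\<^sup>2 + 1 * (norm (u k))\<^sup>2"
    proof -
      have "(A + B) / 2 \<le> M\<^sup>2" using A2 B Mp[of 2] by (simp add: field_simps del: one_le_power)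
      then show ?thesis using B D1 by (intro add_mono mult_right_mono) auto
    qed
    also have "\<dots> \<le> 3 * F k + M\<^sup>2 * (norm (v k))\<^sup>2" using F[of k] by simp
    also have "\<dots> \<le> (3 * M\<^sup>2) * F k + (3 * M\<^sup>2) * (norm (v k))\<^sup>2"
      using F0 Mp[of 2] by (intro add_mono mult_right_mono) auto
    finally show ?thesis by (simp add: distrib_left)
  qed
  have Estep: "E (Suc k) \<le> E k - r * (1 / (8 * M ^ 5) * ((norm (v k))\<^sup>2 + F k))" for k
  proof -
    define d where "d = (a' * r) *\<^sub>R v k - (p * r\<^sup>2) *\<^sub>R G k"
    have d: "u (Suc k) = u k + d"
      by (simp add: u v d_def a'_def p_def algebra_simps power2_eq_square)
    have "E (Suc k) \<le> E k - r * (A * b / 8 * (norm (v k))\<^sup>2 + B * c * F k)"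
      unfolding E_def d
    proof (rule unaccelerated_step[OF d_def v])
      show "F (Suc k) \<le> F k + inner (G k) d + \<kappa> * (norm d)\<^sup>2"
        using descent[of k] by (simp add: d)
      show "A * (1 - b * r) * c = a'" using pos by (simp add: A_def a'_def)
      show "D * a' = B * b" using a'0 by (simp add: D_def)
      show "A * c\<^sup>2 / 2 \<le> p" using pos M by (simp add: A_def p_def power2_eq_square)
      show "r * \<kappa> * (P\<^sup>2 + D / 2 * P\<^sup>2 + B * P + B * (M * P)) \<le> B * c / 8"
        using rQ Bc by simp
      show "r * \<kappa> * (P\<^sup>2 + D / 2 * P\<^sup>2 + B * P + B * (M * P)) \<le> A * b / 16"
      proof (rule order.trans[OF rQ])
        have "1 / (64 * M ^ 5) = 1 / (8 * M ^ 5) / 8" by simp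
        also have "\<dots> \<le> 1 / M ^ 3 / 8 / 8" using le by (rule divide_right_mono) simp
        also have "\<dots> \<le> A * b / 8 / 8" using Ab by (intro divide_right_mono) auto
        also have "\<dots> \<le> A * b / 16" using A0 pos by simp
        finally show "1 / (64 * M ^ 5) \<le> A * b / 16" .
      qed
    qed (use coercive G F0 A0 B D0 pos a'0 r \<kappa> M P rk BA in \<open>auto simp: p_def\<close>)
    also have "\<dots> \<le> E k - r * (1 / (8 * M ^ 5) * (norm (v k))\<^sup>2 + 1 / (8 * M ^ 5) * F k)"
      using Ab le Bc F0 r by (intro diff_left_mono mult_left_mono add_mono mult_right_mono) auto
    finally show ?thesis by (simp add: distrib_left)
  qed
  \<comment> \<open>The rate is \<open>1 / (8 * M ^ 5)\<close> divided by
    \<open>3 * M\<^sup>2\<close>. The dissipation bounds the old energy here, so the decay is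
    explicit at once.\<close>
  define q where "q = 1 - 1 / (24 * M ^ 7) * r"
  have Edecay: "E (Suc k) \<le> q * E k" for k
  proof -
    have "1 / (24 * M ^ 7) * E k \<le> 1 / (24 * M ^ 7) * (3 * M\<^sup>2 * ((norm (v k))\<^sup>2 + F k))"
      using Eub pos by (intro mult_left_mono) auto
    also have "\<dots> = 1 / (8 * M ^ 5) * ((norm (v k))\<^sup>2 + F k)"
      using pos by (simp add: field_simps eval_nat_numeral)
    finally have "r * (1 / (24 * M ^ 7) * E k) \<le> r * (1 / (8 * M ^ 5) * ((norm (v k))\<^sup>2 + F k))"
      using r by (intro mult_left_mono) auto
    then have "E (Suc k) \<le> E k - r * (1 / (24 * M ^ 7) * E k)"
      using Estep[of k] by linarith
    also have "\<dots> = q * E k" by (simp add: q_def algebra_simps)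
    finally show ?thesis .
  qed
  have q0: "0 \<le> q"
  proof -
    have "r * 1 \<le> r * \<kappa>" using \<kappa> r by (intro mult_left_mono) auto
    then have "r \<le> 1" using rk by simp
    moreover have "1 / (24 * M ^ 7) \<le> 1" using Mp[of 7] by (subst divide_le_eq_1) linarith
    ultimately have "1 / (24 * M ^ 7) * r \<le> 1 * 1"
      using r by (intro mult_mono) auto
    then show ?thesis by (simp add: q_def)
  qed
  have "F k \<le> E k" unfolding E_def using A0 BAD by (rule energy_ge)
  also have "\<dots> \<le> q ^ k * E 0"
    using Edecay q0 by (rule geometric_decay)
  also have "\<dots> \<le> q ^ k * (3 * M\<^sup>2 * F 0)"
    using Eub[of 0] v0 q0 by (intro mult_left_mono) auto
  finally show ?thesis by (simp add: q_def mult_ac)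
qed

section \<open>Convergence of the iterates\<close>

text \<open>The step size is eliminated through \<open>s = r\<^sup>2 / \<mu>\<close>, and the
  parameters are fixed numbers. \<open>theta\<close> says that \<open>y\<close> enters the next
  \<open>x\<close> with positive weight.\<close>

locale algorithm_run = smooth_strongly_convex V f g \<mu> L p
  for V :: "'a::real_inner set" and f g \<mu> L p +
  fixes r \<eta> \<nu> \<tau> :: real and x y z :: "nat \<Rightarrow> 'a"
  assumes r_pos: "0 < r" and theta: "0 < 1 + r - \<tau> * r"
    and x0: "x 0 \<in> V" and z0: "z 0 = x 0"
    and y_Suc: "\<And>k. y (Suc k) = x k - (\<eta> * (r\<^sup>2 / \<mu>)) *\<^sub>R g (x k)"
    and z_Suc: "\<And>k. z (Suc k) = (\<nu> * r) *\<^sub>R (x k - (1 / \<mu>) *\<^sub>R g (x k)) + (1 - \<nu> * r) *\<^sub>R z k"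
    and x_Suc: "\<And>k. x (Suc k) = (\<tau> * r / (1 + r)) *\<^sub>R z (Suc k) + (1 - \<tau> * r / (1 + r)) *\<^sub>R y (Suc k)"
begin

section \<open>The rescaled iterates and their recursion\<close>

definition "u k = x k - p"
definition "v k = z k - x k"
definition "G k = (1 / \<mu>) *\<^sub>R g (x k)"
definition "F k = (f (x k) - f p) / \<mu>"
definition "\<kappa> = L / \<mu>"
text \<open>Let \<open>t = \<tau> * r / (1 + r)\<close> be the weight of \<open>z\<close>. The new
  \<open>v\<close> is \<open>1 - t\<close> times \<open>z - y\<close>, while \<open>x - y\<close> is
  \<open>t\<close> times \<open>z - y\<close>, so \<open>a * r = t / (1 - t)\<close> expresses the
  step by the new velocity. Likewise \<open>1 - b * r = (1 - t) * (1 - \<nu> * r)\<close>, and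
  \<open>c\<close> carries the same factor \<open>1 - t\<close>.\<close>

definition "a = \<tau> / (1 + r - \<tau> * r)"
definition "b = \<nu> + \<tau> / (1 + r) * (1 - \<nu> * r)"
definition "c = (1 - \<tau> * r / (1 + r)) * (\<nu> - \<eta> * r)"

lemma iterates_in: "x k \<in> V" "z k \<in> V"
proof (induction k)
  case 0
  show "x 0 \<in> V" "z 0 \<in> V" using x0 z0 by auto
next
  case (Suc k)
  have y: "y (Suc k) \<in> V"
    unfolding y_Suc using Suc subspace grad_in by (intro subspace_diff subspace_scale)
  show z: "z (Suc k) \<in> V"
    unfolding z_Suc using Suc subspace grad_in by (intro subspace_add subspace_diff subspace_scale)
  show "x (Suc k) \<in> V"
    unfolding x_Suc using y z subspace by (intro subspace_add subspace_scale)
qed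

lemma zy_Suc: "z (Suc k) - y (Suc k) = (1 - \<nu> * r) *\<^sub>R v k - ((\<nu> - \<eta> * r) * r) *\<^sub>R G k"
  by (simp add: z_Suc y_Suc v_def G_def algebra_simps power2_eq_square)

lemma v_Suc: "v (Suc k) = (1 - b * r) *\<^sub>R v k - (c * r) *\<^sub>R G k"
proof -
  have "v (Suc k) = (1 - \<tau> * r / (1 + r)) *\<^sub>R (z (Suc k) - y (Suc k))"
    by (simp add: v_def x_Suc algebra_simps)
  also have "\<dots> = ((1 - \<tau> * r / (1 + r)) * (1 - \<nu> * r)) *\<^sub>R v k - (c * r) *\<^sub>R G k"
    by (simp add: zy_Suc c_def scaleR_diff_right mult_ac)
  also have "(1 - \<tau> * r / (1 + r)) * (1 - \<nu> * r) = 1 - b * r"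
    using r_pos by (simp add: b_def field_simps)
  finally show ?thesis .
qed

lemma u_Suc: "u (Suc k) = u k + (a * r) *\<^sub>R v (Suc k) - (\<eta> * r\<^sup>2) *\<^sub>R G k"
proof -
  have *: "1 - \<tau> * r / (1 + r) = (1 + r - \<tau> * r) / (1 + r)"
    using r_pos by (simp add: field_simps)
  have "v (Suc k) = (1 - \<tau> * r / (1 + r)) *\<^sub>R (z (Suc k) - y (Suc k))"
    by (simp add: v_def x_Suc algebra_simps)
  then have "(a * r) *\<^sub>R v (Suc k) = (a * r * (1 - \<tau> * r / (1 + r))) *\<^sub>R (z (Suc k) - y (Suc k))"
    by simp
  also have "a * r * (1 - \<tau> * r / (1 + r)) = \<tau> * r / (1 + r)"
    unfolding * using theta by (simp add: a_def)
  also have "(\<tau> * r / (1 + r)) *\<^sub>R (z (Suc k) - y (Suc k)) = x (Suc k) - y (Suc k)"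
    by (simp add: x_Suc algebra_simps)
  finally show ?thesis
    by (simp add: u_def y_Suc G_def)
qed

lemma v_0: "v 0 = 0"
  by (simp add: v_def z0)

section \<open>Convexity and smoothness in rescaled form\<close>

lemma kappa_ge_1: "1 \<le> \<kappa>"
  using mu_pos mu_le by (simp add: \<kappa>_def)

lemma norm_G_diff: "(norm (G j - G k))\<^sup>2 / (4 * \<kappa>) = (norm (g (x j) - g (x k)))\<^sup>2 / (4 * L) / \<mu>"
  using mu_pos L_pos
  by (simp add: G_def \<kappa>_def scaleR_diff_right[symmetric] power_divide power2_eq_square)

lemma norm_G: "(norm (G k))\<^sup>2 / (4 * \<kappa>) = (norm (g (x k)))\<^sup>2 / (4 * L) / \<mu>"
  using mu_pos L_pos by (simp add: G_def \<kappa>_def power_divide power2_eq_square)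

text \<open>The tangent is taken at the new iterate, as the accelerated energy requires; the gap
  term is what later cancels the product of the two gradients.\<close>

lemma F_convex: "F (Suc k) \<le> F k + inner (G (Suc k)) (u (Suc k) - u k) - (norm (G (Suc k) - G k))\<^sup>2 / (4 * \<kappa>)"
proof -
  have "f (x (Suc k)) + inner (g (x (Suc k))) (x k - x (Suc k))
      + (norm (g (x k) - g (x (Suc k))))\<^sup>2 / (4 * L) \<le> f (x k)"
    by (intro gradient_gap iterates_in)
  then have "(f (x (Suc k)) + inner (g (x (Suc k))) (x k - x (Suc k))
      + (norm (g (x k) - g (x (Suc k))))\<^sup>2 / (4 * L) - f p) / \<mu> \<le> (f (x k) - f p) / \<mu>"
    using mu_pos by (intro divide_right_mono) auto
  then show ?thesis
    unfolding norm_G_diff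
    by (simp add: F_def G_def u_def norm_minus_commute inner_diff_right add_divide_distrib diff_divide_distrib)
qed

text \<open>The tangent at \<open>x k\<close> is evaluated at \<open>p\<close>, where the gradient
  vanishes. The gain is a gradient square, from smoothness; \<open>F_strongly_coercive\<close> gains
  a squared distance instead, from strong convexity.\<close>

lemma F_coercive: "F k + (norm (G k))\<^sup>2 / (4 * \<kappa>) \<le> inner (G k) (u k)"
proof -
  have "f (x k) + inner (g (x k)) (p - x k) + (norm (g p - g (x k)))\<^sup>2 / (4 * L) \<le> f p"
    by (intro gradient_gap iterates_in min_in)
  then have "(f (x k) - f p + (norm (g (x k)))\<^sup>2 / (4 * L)) / \<mu> \<le> inner (g (x k)) (x k - p) / \<mu>"
    using mu_pos by (intro divide_right_mono) (auto simp: gradient_min inner_diff_right)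
  then show ?thesis
    unfolding norm_G by (simp add: F_def G_def u_def add_divide_distrib)
qed

lemma F_ge_norm_G: "(norm (G k))\<^sup>2 / (4 * \<kappa>) \<le> F k"
proof -
  have "f p + inner (g p) (x k - p) + (norm (g (x k) - g p))\<^sup>2 / (4 * L) \<le> f (x k)"
    by (intro gradient_gap iterates_in min_in)
  then show ?thesis
    unfolding norm_G F_def using mu_pos by (intro divide_right_mono) (auto simp: gradient_min)
qed

lemma F_ge_norm_u: "(norm (u k))\<^sup>2 / 2 \<le> F k"
proof -
  have "f p + inner (g p) (x k - p) + \<mu> / 2 * (norm (x k - p))\<^sup>2 \<le> f (x k)"
    by (intro strongly_convex iterates_in min_in)
  then show ?thesis
    using mu_pos by (simp add: gradient_min F_def u_def field_simps)
qed

lemma F_strongly_coercive: "F k + (norm (u k))\<^sup>2 / 2 \<le> inner (G k) (u k)"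
proof -
  have "f (x k) + inner (g (x k)) (p - x k) + \<mu> / 2 * (norm (p - x k))\<^sup>2 \<le> f p"
    by (intro strongly_convex iterates_in min_in)
  then have "(f (x k) - f p + \<mu> / 2 * (norm (x k - p))\<^sup>2) / \<mu> \<le> inner (g (x k)) (x k - p) / \<mu>"
    using mu_pos by (intro divide_right_mono) (auto simp: inner_diff_right norm_minus_commute)
  then show ?thesis
    using mu_pos by (simp add: F_def G_def u_def add_divide_distrib)
qed

lemma F_descent: "F (Suc k) \<le> F k + inner (G k) (u (Suc k) - u k) + \<kappa> * (norm (u (Suc k) - u k))\<^sup>2"
proof -
  have "f (x (Suc k)) \<le> f (x k) + inner (g (x k)) (x (Suc k) - x k) + L * (norm (x (Suc k) - x k))\<^sup>2"
    by (intro descent iterates_in)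
  then have "(f (x (Suc k)) - f p) / \<mu> \<le> (f (x k) + inner (g (x k)) (x (Suc k) - x k)
      + L * (norm (x (Suc k) - x k))\<^sup>2 - f p) / \<mu>"
    using mu_pos by (intro divide_right_mono) auto
  then show ?thesis
    by (simp add: F_def G_def u_def \<kappa>_def add_divide_distrib diff_divide_distrib)
qed

lemma norm_G_le: "norm (G k) \<le> \<kappa> * norm (u k)"
proof -
  have "norm (g (x k) - g p) \<le> L * norm (x k - p)"
    by (intro lipschitz iterates_in min_in)
  then show ?thesis
    using mu_pos by (simp add: gradient_min G_def u_def \<kappa>_def divide_right_mono)
qed

lemma F_0_le: "F 0 \<le> \<kappa> * (norm (u 0))\<^sup>2"
proof -
  have "f (x 0) \<le> f p + inner (g p) (x 0 - p) + L * (norm (x 0 - p))\<^sup>2"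
    by (intro descent iterates_in min_in)
  then show ?thesis
    using mu_pos by (simp add: gradient_min F_def u_def \<kappa>_def divide_right_mono)
qed

text \<open>Multiplication by \<open>\<mu>\<close> undoes the scaling, and \<open>F_0_le\<close>
  turns \<open>F 0\<close> into the squared initial distance with factor \<open>\<kappa>\<close>;
  since \<open>\<mu> * \<kappa> = L\<close>, the prefactor becomes \<open>L\<close>.\<close>

lemma rate_from_scaled:
  assumes "F k \<le> C * F 0 * (1 - C1 * r) ^ k" "0 \<le> C" "0 \<le> 1 - C1 * r"
  shows "f (x k) - f p \<le> C * L * (norm (x 0 - p))\<^sup>2 * (1 - C1 * r) ^ k"
proof -
  have "F k \<le> C * (\<kappa> * (norm (u 0))\<^sup>2) * (1 - C1 * r) ^ k"
    using assms F_0_le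
    by (intro order.trans[OF assms(1)] mult_right_mono mult_left_mono zero_le_power)
  then have "\<mu> * F k \<le> \<mu> * (C * (\<kappa> * (norm (u 0))\<^sup>2) * (1 - C1 * r) ^ k)"
    using mu_pos by (intro mult_left_mono) auto
  moreover have "\<mu> * F k = f (x k) - f p" "\<mu> * (C * (\<kappa> * (norm (u 0))\<^sup>2) * (1 - C1 * r) ^ k)
      = C * L * (norm (x 0 - p))\<^sup>2 * (1 - C1 * r) ^ k"
    using mu_pos by (simp_all add: F_def \<kappa>_def u_def)
  ultimately show ?thesis by simp
qed

text \<open>One number \<open>M\<close> bounds all coefficients, and \<open>a\<close>,
  \<open>b\<close>, \<open>c\<close> also away from zero; it will be chosen from the parameter
  functions alone, which keeps the constants of the rates uniform.\<close>

context
  fixes M :: real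
  assumes M: "1 \<le> M" "1 / M \<le> a" "a \<le> M" "1 / M \<le> b" "b \<le> M" "1 / M \<le> c" "c \<le> M" "0 \<le> \<eta>" "\<eta> \<le> M"
    and r_le: "r \<le> 1" "b * r \<le> 1 / 2"
begin

lemma factor_nonneg: "0 \<le> 1 - 1 / (real m * M ^ j) * r"
proof -
  have "1 / (real m * M ^ j) \<le> 1"
    using M one_le_power[of M j] by (cases m) (auto simp: divide_le_eq_1 intro: mult_ge1_I)
  then have "1 / (real m * M ^ j) * r \<le> 1 * 1"
    using r_pos r_le M by (intro mult_mono) auto
  then show ?thesis by simp
qed

lemma unaccelerated_convergence:
  assumes "r * \<kappa> * (512 * M ^ 9) \<le> 1"
  shows "f (x k) - f p \<le> 3 * M\<^sup>2 * L * (norm (x 0 - p))\<^sup>2 * (1 - 1 / (24 * M ^ 7) * r) ^ k"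
proof (rule rate_from_scaled)
  show "F k \<le> 3 * M\<^sup>2 * F 0 * (1 - 1 / (24 * M ^ 7) * r) ^ k"
    using u_Suc v_Suc v_0 F_descent F_strongly_coercive norm_G_le F_ge_norm_u M r_pos r_le(2) kappa_ge_1 assms
    by (rule unaccelerated_rate)
qed (use factor_nonneg[of 24 7] in auto)

lemma accelerated_convergence:
  assumes "0 \<le> K" "a * c / (2 * (1 - b * r)) - \<eta> \<le> K * r" "\<kappa> * r\<^sup>2 * (64 * M ^ 5 * (K + 1)) \<le> 1"
  shows "f (x k) - f p \<le> 40 * M ^ 4 * L * (norm (x 0 - p))\<^sup>2 * (1 - 1 / (320 * M ^ 9) * r) ^ k"
proof (rule rate_from_scaled)
  have "v (Suc 0) = - ((c * r) *\<^sub>R G 0)" by (simp add: v_Suc v_0)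
  moreover have "0 < \<kappa>" using kappa_ge_1 by simp
  ultimately show "F k \<le> 40 * M ^ 4 * F 0 * (1 - 1 / (320 * M ^ 9) * r) ^ k"
    using u_Suc v_Suc F_convex F_coercive F_ge_norm_G F_ge_norm_u M r_pos r_le assms
    by (intro accelerated_rate[where w = "\<lambda>k. v (Suc k)" and u = u and G = G])
qed (use factor_nonneg[of 320 9] M in auto)

end

end

section \<open>The parameter functions\<close>

lemma differentiable_right_le_linear:
  fixes h :: "real \<Rightarrow> real"
  assumes "h differentiable (at 0)" "h 0 \<le> 0"
  obtains K where "0 \<le> K" "\<forall>\<^sub>F r in at_right 0. h r \<le> K * r"
proof -
  obtain d where "(h has_real_derivative d) (at 0)"
    using assms(1) by (auto simp: real_differentiable_def)
  then have "((\<lambda>r. (h r - h 0) / r) \<longlongrightarrow> d) (at_right 0)"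
    using has_field_derivative_iff[of h d 0 UNIV] by (auto intro: filterlim_at_split[THEN iffD1, THEN conjunct2])
  then have "\<forall>\<^sub>F r in at_right 0. (h r - h 0) / r < \<bar>d\<bar> + 1"
    by (rule order_tendstoD) simp
  moreover have "\<forall>\<^sub>F r::real in at_right 0. 0 < r"
    by (rule eventually_at_right_less)
  ultimately have "\<forall>\<^sub>F r in at_right 0. h r \<le> (\<bar>d\<bar> + 1) * r"
  proof eventually_elim
    case (elim r)
    then have "h r - h 0 < (\<bar>d\<bar> + 1) * r" by (simp add: divide_less_eq)
    with assms(2) show ?case by linarith
  qed
  then show ?thesis by (rule that[rotated]) simp
qed

lemma has_fps_expansion_imp_differentiable_at_0:
  fixes \<phi> :: "real \<Rightarrow> real"
  assumes "\<phi> has_fps_expansion \<Phi>"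
  obtains d where "(\<phi> has_real_derivative d) (at 0)" "\<phi> 0 = fps_nth \<Phi> 0"
proof
  have "(eval_fps \<Phi> has_real_derivative eval_fps (fps_deriv \<Phi>) 0) (at 0)"
    using assms by (intro has_field_derivative_eval_fps) (auto simp: has_fps_expansion_def zero_ereal_def)
  moreover have ev: "eventually (\<lambda>x. eval_fps \<Phi> x = \<phi> x) (nhds 0)"
    using assms by (simp add: has_fps_expansion_def)
  ultimately show "(\<phi> has_real_derivative eval_fps (fps_deriv \<Phi>) 0) (at 0)"
    using DERIV_cong_ev[OF refl ev refl] by simp
  show "\<phi> 0 = fps_nth \<Phi> 0"
    using eventually_nhds_x_imp_x[OF ev] by (simp add: eval_fps_at_0)
qed

lemma parameter_function_facts:
  assumes "parameter_function \<phi> \<Phi>"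
  shows "\<phi> differentiable (at 0)" "\<phi> 0 = fps_nth \<Phi> 0" "(\<phi> \<longlongrightarrow> fps_nth \<Phi> 0) (at_right 0)"
    "\<forall>\<^sub>F r in at_right 0. 0 \<le> \<phi> r"
proof -
  have exp: "\<phi> has_fps_expansion \<Phi>" using assms by (simp add: parameter_function_def)
  obtain d where d: "(\<phi> has_real_derivative d) (at 0)" "\<phi> 0 = fps_nth \<Phi> 0"
    using has_fps_expansion_imp_differentiable_at_0[OF exp] by blast
  show "\<phi> differentiable (at 0)" "\<phi> 0 = fps_nth \<Phi> 0"
    using d by (auto simp: real_differentiable_def)
  have "(\<phi> \<longlongrightarrow> \<phi> 0) (at 0)"
    using DERIV_isCont[OF d(1)] by (simp add: isCont_def)
  then show "(\<phi> \<longlongrightarrow> fps_nth \<Phi> 0) (at_right 0)"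
    using d(2) by (simp add: filterlim_at_split)
  obtain q0 where q0: "q0 > 0" "\<And>q. 0 \<le> q \<Longrightarrow> q \<le> q0 \<Longrightarrow> 0 \<le> \<phi> (sqrt q)"
    using assms by (auto simp: parameter_function_def)
  have "\<forall>\<^sub>F r in at_right 0. 0 < r \<and> r < sqrt q0"
    using q0(1) eventually_at_right_less[of 0] eventually_at_right_real[of 0 "sqrt q0"] by auto
  then show "\<forall>\<^sub>F r in at_right 0. 0 \<le> \<phi> r"
  proof eventually_elim
    case (elim r)
    then have "r\<^sup>2 \<le> (sqrt q0)\<^sup>2" by (intro power_mono) auto
    then show ?case using q0(2)[of "r\<^sup>2"] q0(1) elim by simp
  qed
qed

lemma eventually_reciprocal_bounds:
  fixes h :: "'a \<Rightarrow> real"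
  assumes "(h \<longlongrightarrow> l) Fl" "2 / l \<le> M" "2 * l \<le> M" "0 < l"
  shows "\<forall>\<^sub>F r in Fl. 1 / M \<le> h r \<and> h r \<le> M"
proof -
  have "0 < M" using assms by simp
  have "\<forall>\<^sub>F r in Fl. l / 2 < h r"
    by (rule order_tendstoD[OF assms(1)]) (use assms(4) in simp)
  moreover have "\<forall>\<^sub>F r in Fl. h r < 2 * l"
    by (rule order_tendstoD[OF assms(1)]) (use assms(4) in simp)
  ultimately show ?thesis
  proof eventually_elim
    case (elim r)
    have "1 / M \<le> l / 2" using assms \<open>0 < M\<close> by (simp add: field_simps)
    with elim assms show ?case by linarith
  qed
qed

text \<open>Apart from the sign of \<open>\<eta>\<close>, which is assumed, each bound but the last
  holds with room to spare in the limit at 0 from the right, hence for all small \<open>r\<close>.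
  The left side of the last one equals
  \<open>\<nu>\<^sub>0 * \<tau>\<^sub>0 / 2 - \<eta>\<^sub>0\<close> at 0, possibly zero, so its
  linear bound is drawn from differentiability. It is an implication so that both cases share the
  lemma.\<close>

lemma parameter_bounds:
  fixes \<eta> \<nu> \<tau> :: "real \<Rightarrow> real"
  assumes \<eta>: "parameter_function \<eta> E" and \<nu>: "parameter_function \<nu> N" and \<tau>: "parameter_function \<tau> T"
    and \<nu>0: "0 < fps_nth N 0" and \<tau>0: "0 < fps_nth T 0"
  defines "a \<equiv> \<lambda>r. \<tau> r / (1 + r - \<tau> r * r)"
    and "b \<equiv> \<lambda>r. \<nu> r + \<tau> r / (1 + r) * (1 - \<nu> r * r)"
    and "c \<equiv> \<lambda>r. (1 - \<tau> r * r / (1 + r)) * (\<nu> r - \<eta> r * r)"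
  obtains \<delta> M K where "0 < \<delta>" "1 \<le> M" "0 \<le> K"
    "\<And>r. 0 < r \<Longrightarrow> r \<le> \<delta> \<Longrightarrow> 1 / M \<le> a r \<and> a r \<le> M \<and> 1 / M \<le> b r \<and> b r \<le> M
      \<and> 1 / M \<le> c r \<and> c r \<le> M \<and> 0 \<le> \<eta> r \<and> \<eta> r \<le> M \<and> r \<le> 1 \<and> b r * r \<le> 1 / 2
      \<and> 0 < 1 + r - \<tau> r * r
      \<and> (fps_nth E 0 \<ge> fps_nth N 0 * fps_nth T 0 / 2
          \<longrightarrow> a r * c r / (2 * (1 - b r * r)) - \<eta> r \<le> K * r)"
proof -
  define \<eta>\<^sub>0 \<nu>\<^sub>0 \<tau>\<^sub>0 where "\<eta>\<^sub>0 = fps_nth E 0" "\<nu>\<^sub>0 = fps_nth N 0" "\<tau>\<^sub>0 = fps_nth T 0"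
  note limits = parameter_function_facts(3)[OF \<eta>, folded \<eta>\<^sub>0_\<nu>\<^sub>0_\<tau>\<^sub>0_def(1)]
    parameter_function_facts(3)[OF \<nu>, folded \<eta>\<^sub>0_\<nu>\<^sub>0_\<tau>\<^sub>0_def(2)]
    parameter_function_facts(3)[OF \<tau>, folded \<eta>\<^sub>0_\<nu>\<^sub>0_\<tau>\<^sub>0_def(3)]
  have pos: "0 < \<nu>\<^sub>0" "0 < \<tau>\<^sub>0" using \<nu>0 \<tau>0 by (simp_all add: \<eta>\<^sub>0_\<nu>\<^sub>0_\<tau>\<^sub>0_def)
  have eta0: "0 \<le> \<eta>\<^sub>0"
    using limits(1) parameter_function_facts(4)[OF \<eta>] trivial_limit_at_right_real
    by (intro tendsto_lowerbound) auto
  \<comment> \<open>A sum that dominates twice the limits of \<open>a\<close>, \<open>b\<close>,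
    \<open>c\<close> and twice their reciprocals; for the limit
    \<open>\<nu>\<^sub>0 + \<tau>\<^sub>0\<close> the reciprocal is below that of
    \<open>\<nu>\<^sub>0\<close>.\<close>
  define M where "M = 1 + 2 / \<nu>\<^sub>0 + 2 / \<tau>\<^sub>0 + 2 * \<nu>\<^sub>0 + 2 * \<tau>\<^sub>0 + \<eta>\<^sub>0"
  have qpos: "0 < 2 / \<nu>\<^sub>0" "0 < 2 / \<tau>\<^sub>0" using pos by auto
  have M: "1 \<le> M" "2 / \<nu>\<^sub>0 \<le> M" "2 / \<tau>\<^sub>0 \<le> M" "2 * \<nu>\<^sub>0 \<le> M" "2 * \<tau>\<^sub>0 \<le> M"
    "2 * (\<nu>\<^sub>0 + \<tau>\<^sub>0) \<le> M" "1 + \<eta>\<^sub>0 \<le> M"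
    unfolding M_def using pos eta0 qpos by (simp_all add: add_nonneg_nonneg)
  have M': "2 / (\<nu>\<^sub>0 + \<tau>\<^sub>0) \<le> M"
    using pos by (intro order.trans[OF _ M(2)] frac_le) auto
  have lims: "((\<lambda>r. 1 + r - \<tau> r * r) \<longlongrightarrow> 1) (at_right 0)" "(a \<longlongrightarrow> \<tau>\<^sub>0) (at_right 0)"
    "(b \<longlongrightarrow> \<nu>\<^sub>0 + \<tau>\<^sub>0) (at_right 0)" "(c \<longlongrightarrow> \<nu>\<^sub>0) (at_right 0)"
    "((\<lambda>r. b r * r) \<longlongrightarrow> 0) (at_right 0)"
    unfolding a_def b_def c_def by (auto intro!: tendsto_eq_intros limits)
  define h where "h r = a r * c r / (2 * (1 - b r * r)) - \<eta> r" for r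
  obtain K where K: "0 \<le> K" "\<nu>\<^sub>0 * \<tau>\<^sub>0 / 2 \<le> \<eta>\<^sub>0 \<longrightarrow> (\<forall>\<^sub>F r in at_right 0. h r \<le> K * r)"
  proof (cases "\<nu>\<^sub>0 * \<tau>\<^sub>0 / 2 \<le> \<eta>\<^sub>0")
    case True
    have "h differentiable (at 0)"
      unfolding h_def a_def b_def c_def
      by (intro derivative_intros parameter_function_facts(1)[OF \<eta>] parameter_function_facts(1)[OF \<nu>]
          parameter_function_facts(1)[OF \<tau>]) auto
    moreover have "h 0 \<le> 0"
      using True parameter_function_facts(2)[OF \<eta>] parameter_function_facts(2)[OF \<nu>]
        parameter_function_facts(2)[OF \<tau>]
      by (simp add: h_def a_def b_def c_def \<eta>\<^sub>0_\<nu>\<^sub>0_\<tau>\<^sub>0_def mult.commute)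
    ultimately show ?thesis
      using differentiable_right_le_linear that by blast
  next
    case False
    then show ?thesis using that[of 0] by simp
  qed
  let ?P = "\<lambda>r. 1 / M \<le> a r \<and> a r \<le> M \<and> 1 / M \<le> b r \<and> b r \<le> M
      \<and> 1 / M \<le> c r \<and> c r \<le> M \<and> 0 \<le> \<eta> r \<and> \<eta> r \<le> M \<and> r \<le> 1 \<and> b r * r \<le> 1 / 2
      \<and> 0 < 1 + r - \<tau> r * r
      \<and> (\<eta>\<^sub>0 \<ge> \<nu>\<^sub>0 * \<tau>\<^sub>0 / 2 \<longrightarrow> h r \<le> K * r)"
  have "\<forall>\<^sub>F r in at_right 0. ?P r"
  proof -
    have "\<forall>\<^sub>F r in at_right 0. 1 / M \<le> a r \<and> a r \<le> M" "\<forall>\<^sub>F r in at_right 0. 1 / M \<le> b r \<and> b r \<le> M"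
      "\<forall>\<^sub>F r in at_right 0. 1 / M \<le> c r \<and> c r \<le> M"
      using eventually_reciprocal_bounds[OF lims(2)] eventually_reciprocal_bounds[OF lims(3)]
        eventually_reciprocal_bounds[OF lims(4)] M M' pos by auto
    moreover have "\<forall>\<^sub>F r in at_right 0. \<eta> r < 1 + \<eta>\<^sub>0"
      using limits(1) by (rule order_tendstoD) simp
    moreover have "\<forall>\<^sub>F r in at_right 0. b r * r < 1 / 2"
      using lims(5) by (rule order_tendstoD) simp
    moreover have "\<forall>\<^sub>F r in at_right 0. 0 < 1 + r - \<tau> r * r"
      using lims(1) by (rule order_tendstoD) simp
    moreover have "\<forall>\<^sub>F r in at_right 0. r < (1::real)"
      by (rule order_tendstoD[OF tendsto_ident_at]) simp
    moreover have "\<forall>\<^sub>F r in at_right 0. \<eta>\<^sub>0 \<ge> \<nu>\<^sub>0 * \<tau>\<^sub>0 / 2 \<longrightarrow> h r \<le> K * r"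
      using K(2) by (cases "\<eta>\<^sub>0 \<ge> \<nu>\<^sub>0 * \<tau>\<^sub>0 / 2") auto
    ultimately show ?thesis
      using parameter_function_facts(4)[OF \<eta>]
    proof eventually_elim
      case (elim r)
      have "\<eta> r \<le> M" using elim(4) M(7) by linarith
      with elim show ?case by auto
    qed
  qed
  then obtain \<delta> where \<delta>: "0 < \<delta>" "\<And>r. 0 < r \<Longrightarrow> r < \<delta> \<Longrightarrow> ?P r"
    by (auto simp: eventually_at_right_field)
  show ?thesis
  proof (rule that[of "\<delta> / 2" M K])
    show "0 < \<delta> / 2" "1 \<le> M" "0 \<le> K" using \<delta>(1) M K by auto
  next
    fix r :: real
    assume "0 < r" "r \<le> \<delta> / 2"
    with \<delta>(1) have "?P r" by (intro \<delta>(2)) auto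
    then show "1 / M \<le> a r \<and> a r \<le> M \<and> 1 / M \<le> b r \<and> b r \<le> M
      \<and> 1 / M \<le> c r \<and> c r \<le> M \<and> 0 \<le> \<eta> r \<and> \<eta> r \<le> M \<and> r \<le> 1 \<and> b r * r \<le> 1 / 2
      \<and> 0 < 1 + r - \<tau> r * r
      \<and> (fps_nth E 0 \<ge> fps_nth N 0 * fps_nth T 0 / 2
          \<longrightarrow> a r * c r / (2 * (1 - b r * r)) - \<eta> r \<le> K * r)"
      unfolding h_def \<eta>\<^sub>0_\<nu>\<^sub>0_\<tau>\<^sub>0_def .
  qed
qed

section \<open>Gradients on the coordinate subspaces\<close>

lemma Rn_basis:
  fixes h :: fseq
  defines "e \<equiv> \<lambda>i::nat. Abs_fseq (\<lambda>j. if j = i then 1 else 0)"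
  assumes "h \<in> Rn n"
  shows "h = (\<Sum>i<n. coord h i *\<^sub>R e i)"
proof -
  have e: "coord (e i) j = (if j = i then 1 else 0)" for i j
    unfolding e_def by (subst Abs_fseq_inverse) auto
  have "coord (\<Sum>i\<in>I. coord h i *\<^sub>R e i) j = (\<Sum>i\<in>I. coord h i * coord (e i) j)" for I j
    by (induction I rule: infinite_finite_induct) auto
  with assms(2) show ?thesis
    by (intro fseq_eqI) (auto simp: e Rn_def if_distrib cong: if_cong)
qed

text \<open>Riesz representation on \<open>Rn n\<close>, done in coordinates: the entries of
  \<open>v\<close> are the values of \<open>\<phi>\<close> on the unit vectors, cut off at
  \<open>n\<close>.\<close>

lemma Rn_representer:
  fixes \<phi> :: "fseq \<Rightarrow> real"
  assumes "linear \<phi>"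
  obtains v where "v \<in> Rn n" "\<And>h. h \<in> Rn n \<Longrightarrow> \<phi> h = inner v h"
proof
  define e where "e = (\<lambda>i::nat. Abs_fseq (\<lambda>j. if j = i then 1 else 0))"
  define v where "v = Abs_fseq (\<lambda>i. if i < n then \<phi> (e i) else 0)"
  have "finite {i. i < n \<and> \<phi> (e i) \<noteq> 0}" by simp
  then have v: "coord v i = (if i < n then \<phi> (e i) else 0)" for i
    unfolding v_def by (subst Abs_fseq_inverse) (auto simp: conj_commute)
  then show V: "v \<in> Rn n" by (simp add: Rn_def)
  show "\<phi> h = inner v h" if "h \<in> Rn n" for h
  proof -
    have "\<phi> h = \<phi> (\<Sum>i<n. coord h i *\<^sub>R e i)"
      using Rn_basis[OF that] by (simp add: e_def)
    also have "\<dots> = (\<Sum>i<n. coord h i * \<phi> (e i))"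
      using assms by (simp add: linear_sum linear_cmul)
    also have "\<dots> = inner v h"
      by (simp add: inner_Rn[OF V] v mult.commute)
    finally show ?thesis .
  qed
qed

text \<open>\<open>grad\<close> is a definite description, so existence and uniqueness are both at
  stake. Existence comes from representing the derivative by a vector of \<open>Rn n\<close>. For
  uniqueness, the difference \<open>d\<close> of two candidates is a derivative of the zero
  function, and along the line through \<open>x\<close> in direction \<open>d\<close> this forces
  \<open>inner d d = 0\<close>.\<close>

lemma grad_in_Rn:
  assumes "f differentiable_on Rn n" "x \<in> Rn n"
  shows "grad n f x \<in> Rn n"
proof -
  let ?P = "\<lambda>v. v \<in> Rn n \<and> (f has_derivative (\<lambda>h. inner v h)) (at x within Rn n)"
  obtain D where D: "(f has_derivative D) (at x within Rn n)"
    using assms by (auto simp: differentiable_on_def differentiable_def)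
  obtain v where v: "v \<in> Rn n" "\<And>h. h \<in> Rn n \<Longrightarrow> D h = inner v h"
    using Rn_representer has_derivative_linear[OF D] by metis
  have diff: "y - x \<in> Rn n" if "y \<in> Rn n" for y
    using subspace_Rn that assms(2) by (rule subspace_diff)
  have "((\<lambda>y. (f y - f x - D (y - x)) /\<^sub>R norm (y - x)) \<longlongrightarrow> 0) (at x within Rn n)"
    using D by (simp add: has_derivative_at_within)
  \<comment> \<open>\<open>D\<close> and \<open>inner v\<close> are known to agree only on
    \<open>Rn n\<close>, which suffices because the limit within \<open>Rn n\<close> sees only
    differences \<open>y - x\<close> from that subspace.\<close>
  then have "((\<lambda>y. (f y - f x - inner v (y - x)) /\<^sub>R norm (y - x)) \<longlongrightarrow> 0) (at x within Rn n)"
    by (rule Lim_transform_within[OF _ zero_less_one]) (simp add: v(2) diff)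
  then have Pv: "?P v"
    using v(1) by (simp add: has_derivative_at_within bounded_linear_inner_right)
  have "v' = v" if "?P v'" for v'
  proof -
    define d where "d = v' - v"
    have d: "d \<in> Rn n"
      unfolding d_def using subspace_Rn that v(1) by (intro subspace_diff) auto
    have "((\<lambda>h. 0) has_derivative (\<lambda>h. inner d h)) (at x within Rn n)"
      using has_derivative_diff[of f "\<lambda>h. inner v' h" "at x within Rn n" f "\<lambda>h. inner v h"] that Pv
      by (simp add: d_def inner_diff_left)
    moreover have "((\<lambda>t. x + t *\<^sub>R d) has_derivative (\<lambda>t. t *\<^sub>R d)) (at 0)"
      by (auto intro!: derivative_eq_intros)
    moreover have "range (\<lambda>t. x + t *\<^sub>R d) \<subseteq> Rn n"
      using d assms(2) subspace_Rn by (auto intro!: subspace_add subspace_scale)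
    ultimately have "((\<lambda>t::real. 0::real) has_derivative (\<lambda>t. inner d (t *\<^sub>R d))) (at 0)"
      using has_derivative_in_compose[of "\<lambda>t. x + t *\<^sub>R d" "\<lambda>t. t *\<^sub>R d" 0 UNIV "\<lambda>h. 0::real" "\<lambda>h. inner d h"]
      by (simp add: has_derivative_subset)
    then have "(\<lambda>t. inner d (t *\<^sub>R d)) = (\<lambda>t. 0)"
      by (rule has_derivative_unique) simp
    then have "inner d (1 *\<^sub>R d) = 0" by (rule fun_cong)
    then show ?thesis by (simp add: d_def)
  qed
  with Pv have "?P (grad n f x)"
    unfolding grad_def by (rule theI)
  then show ?thesis by simp
qed

section \<open>Convergence rates\<close>

lemma S1_smooth_strongly_convex:
  assumes "f \<in> S1 n \<mu> L" "0 < \<mu>" "\<mu> \<le> L" "is_arg_min f (\<lambda>u. u \<in> Rn n) p"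
  shows "smooth_strongly_convex (Rn n) f (grad n f) \<mu> L p"
  using assms grad_in_Rn[of f n] subspace_Rn[of n]
  by unfold_locales (auto simp: S1_def is_arg_min_def not_less)

lemma algorithm_A_run:
  assumes "f \<in> S1 n \<mu> L" "0 < \<mu>" "\<mu> \<le> L" "is_arg_min f (\<lambda>u. u \<in> Rn n) p" "0 < s"
    and alg: "algorithm_A n f \<mu> s \<eta> \<nu> \<tau> x y z"
    and r: "r = sqrt (\<mu> * s)" and theta: "0 < 1 + r - \<tau> * r"
  shows "algorithm_run (Rn n) f (grad n f) \<mu> L p r \<eta> \<nu> \<tau> x y z"
proof -
  interpret smooth_strongly_convex "Rn n" f "grad n f" \<mu> L p
    using assms by (intro S1_smooth_strongly_convex)
  have "r\<^sup>2 / \<mu> = s" using assms by (simp add: r)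
  then show ?thesis
    using alg theta assms(2,5) unfolding algorithm_A_def Let_def r
    by unfold_locales auto
qed

theorem theorem2:
  fixes \<eta> \<nu> \<tau> :: "real \<Rightarrow> real" and E N T :: "real fps"
  assumes "parameter_function \<eta> E" and "parameter_function \<nu> N" and "parameter_function \<tau> T"
  defines "\<eta>\<^sub>0 \<equiv> fps_nth E 0" and "\<nu>\<^sub>0 \<equiv> fps_nth N 0" and "\<tau>\<^sub>0 \<equiv> fps_nth T 0"
  shows
    "(\<nu>\<^sub>0 > 0 \<and> \<tau>\<^sub>0 > 0 \<and> \<nu>\<^sub>0 \<noteq> \<tau>\<^sub>0 \<and> 0 \<le> \<eta>\<^sub>0 \<and> \<eta>\<^sub>0 < \<nu>\<^sub>0 * \<tau>\<^sub>0 / 2 \<longrightarrow>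
       (\<exists>C>0. \<exists>C\<^sub>0>0. \<exists>C\<^sub>1>0. \<forall>n \<mu> L f xstar s x y z.
          n \<ge> 1 \<and> 0 < \<mu> \<and> \<mu> \<le> L \<and> f \<in> S1 n \<mu> L \<and> is_arg_min f (\<lambda>u. u \<in> Rn n) xstar \<and>
          0 < s \<and> s \<le> C\<^sub>0 * \<mu> / L\<^sup>2 \<and>
          algorithm_A n f \<mu> s (\<eta> (sqrt (\<mu> * s))) (\<nu> (sqrt (\<mu> * s))) (\<tau> (sqrt (\<mu> * s))) x y z \<longrightarrow>
          (\<forall>k\<ge>1. f (x k) - f xstar
                    \<le> C * L * (norm (x 0 - xstar))\<^sup>2 * (1 - C\<^sub>1 * sqrt (\<mu> * s)) ^ k)))
     \<and>
     (\<nu>\<^sub>0 > 0 \<and> \<tau>\<^sub>0 > 0 \<and> \<nu>\<^sub>0 \<noteq> \<tau>\<^sub>0 \<and> \<eta>\<^sub>0 \<ge> \<nu>\<^sub>0 * \<tau>\<^sub>0 / 2 \<longrightarrow>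
       (\<exists>C>0. \<exists>C\<^sub>0>0. \<exists>C\<^sub>1>0. \<forall>n \<mu> L f xstar s x y z.
          n \<ge> 1 \<and> 0 < \<mu> \<and> \<mu> \<le> L \<and> f \<in> S1 n \<mu> L \<and> is_arg_min f (\<lambda>u. u \<in> Rn n) xstar \<and>
          0 < s \<and> s \<le> C\<^sub>0 / L \<and>
          algorithm_A n f \<mu> s (\<eta> (sqrt (\<mu> * s))) (\<nu> (sqrt (\<mu> * s))) (\<tau> (sqrt (\<mu> * s))) x y z \<longrightarrow>
          (\<forall>k\<ge>1. f (x k) - f xstar
                    \<le> C * L * (norm (x 0 - xstar))\<^sup>2 * (1 - C\<^sub>1 * sqrt (\<mu> * s)) ^ k)))"
proof (intro conjI impI; elim conjE)
  assume "\<nu>\<^sub>0 > 0" "\<tau>\<^sub>0 > 0"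
  then obtain \<delta> M K where \<delta>: "0 < \<delta>" and M: "1 \<le> M"
    and bounds: "\<And>r. 0 < r \<Longrightarrow> r \<le> \<delta> \<Longrightarrow>
      1 / M \<le> \<tau> r / (1 + r - \<tau> r * r) \<and> \<tau> r / (1 + r - \<tau> r * r) \<le> M
      \<and> 1 / M \<le> \<nu> r + \<tau> r / (1 + r) * (1 - \<nu> r * r)
      \<and> \<nu> r + \<tau> r / (1 + r) * (1 - \<nu> r * r) \<le> M
      \<and> 1 / M \<le> (1 - \<tau> r * r / (1 + r)) * (\<nu> r - \<eta> r * r)
      \<and> (1 - \<tau> r * r / (1 + r)) * (\<nu> r - \<eta> r * r) \<le> M
      \<and> 0 \<le> \<eta> r \<and> \<eta> r \<le> M \<and> r \<le> 1
      \<and> (\<nu> r + \<tau> r / (1 + r) * (1 - \<nu> r * r)) * r \<le> 1 / 2 \<and> 0 < 1 + r - \<tau> r * r"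
    using parameter_bounds[OF assms(1-3)] unfolding \<nu>\<^sub>0_def \<tau>\<^sub>0_def by metis
  \<comment> \<open>\<open>s \<le> \<epsilon>\<^sup>2 * \<mu> / L\<^sup>2\<close> amounts to
    \<open>r * (L / \<mu>) \<le> \<epsilon>\<close>, so \<open>\<epsilon>\<close> is the threshold
    for \<open>r * \<kappa>\<close> and \<open>\<epsilon>\<^sup>2\<close> becomes
    \<open>C\<^sub>0\<close>. As \<open>r \<le> r * \<kappa>\<close>, it also gives
    \<open>r \<le> \<delta>\<close>.\<close>
  define \<epsilon> where "\<epsilon> = min \<delta> (1 / (512 * M ^ 9))"
  have \<epsilon>: "0 < \<epsilon>" "\<epsilon> \<le> \<delta>" "\<epsilon> * (512 * M ^ 9) \<le> 1"
    using \<delta> M by (auto simp: \<epsilon>_def min_def field_simps)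
  have "f (x k) - f xstar \<le> 3 * M\<^sup>2 * L * (norm (x 0 - xstar))\<^sup>2 * (1 - 1 / (24 * M ^ 7) * sqrt (\<mu> * s)) ^ k"
    if *: "0 < \<mu>" "\<mu> \<le> L" "f \<in> S1 n \<mu> L" "is_arg_min f (\<lambda>u. u \<in> Rn n) xstar"
      "0 < s" "s \<le> \<epsilon>\<^sup>2 * \<mu> / L\<^sup>2"
      "algorithm_A n f \<mu> s (\<eta> (sqrt (\<mu> * s))) (\<nu> (sqrt (\<mu> * s))) (\<tau> (sqrt (\<mu> * s))) x y z"
    for n \<mu> L f xstar s x y z k
  proof -
    define r where "r = sqrt (\<mu> * s)"
    have r: "0 < r" using * by (simp add: r_def)
    have "\<mu> * s \<le> (\<epsilon> * \<mu> / L)\<^sup>2"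
      using mult_left_mono[OF *(6), of \<mu>] * by (simp add: power_mult_distrib power_divide power2_eq_square mult_ac)
    then have "r \<le> \<epsilon> * \<mu> / L"
      unfolding r_def using * \<epsilon> by (intro real_le_lsqrt) auto
    then have rk: "r * (L / \<mu>) \<le> \<epsilon>"
      using * by (simp add: field_simps)
    moreover have "r * 1 \<le> r * (L / \<mu>)"
      using r * by (intro mult_left_mono) auto
    ultimately have "r \<le> \<delta>" using \<epsilon> by linarith
    note bounds = bounds[OF r this]
    interpret algorithm_run "Rn n" f "grad n f" \<mu> L xstar r "\<eta> r" "\<nu> r" "\<tau> r" x y z
      using * bounds by (intro algorithm_A_run[OF _ _ _ _ _ _ r_def]) (auto simp: r_def)
    have "r * \<kappa> * (512 * M ^ 9) \<le> \<epsilon> * (512 * M ^ 9)"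
      using rk M by (intro mult_right_mono) (auto simp: \<kappa>_def)
    then have "r * \<kappa> * (512 * M ^ 9) \<le> 1" using \<epsilon> by linarith
    then show ?thesis
      unfolding r_def[symmetric]
      using bounds M by (intro unaccelerated_convergence) (auto simp: a_def b_def c_def)
  qed
  then show "\<exists>C>0. \<exists>C\<^sub>0>0. \<exists>C\<^sub>1>0. \<forall>n \<mu> L f xstar s x y z.
          n \<ge> 1 \<and> 0 < \<mu> \<and> \<mu> \<le> L \<and> f \<in> S1 n \<mu> L \<and> is_arg_min f (\<lambda>u. u \<in> Rn n) xstar \<and>
          0 < s \<and> s \<le> C\<^sub>0 * \<mu> / L\<^sup>2 \<and>
          algorithm_A n f \<mu> s (\<eta> (sqrt (\<mu> * s))) (\<nu> (sqrt (\<mu> * s))) (\<tau> (sqrt (\<mu> * s))) x y z \<longrightarrow>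
          (\<forall>k\<ge>1. f (x k) - f xstar
                    \<le> C * L * (norm (x 0 - xstar))\<^sup>2 * (1 - C\<^sub>1 * sqrt (\<mu> * s)) ^ k)"
    using M \<epsilon> by (intro exI[of _ "3 * M\<^sup>2"] exI[of _ "\<epsilon>\<^sup>2"] exI[of _ "1 / (24 * M ^ 7)"] conjI) auto
next
  assume "\<nu>\<^sub>0 > 0" "\<tau>\<^sub>0 > 0" "\<eta>\<^sub>0 \<ge> \<nu>\<^sub>0 * \<tau>\<^sub>0 / 2"
  then obtain \<delta> M K where \<delta>: "0 < \<delta>" and M: "1 \<le> M" and K: "0 \<le> K"
    and bounds: "\<And>r. 0 < r \<Longrightarrow> r \<le> \<delta> \<Longrightarrow>
      1 / M \<le> \<tau> r / (1 + r - \<tau> r * r) \<and> \<tau> r / (1 + r - \<tau> r * r) \<le> M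
      \<and> 1 / M \<le> \<nu> r + \<tau> r / (1 + r) * (1 - \<nu> r * r)
      \<and> \<nu> r + \<tau> r / (1 + r) * (1 - \<nu> r * r) \<le> M
      \<and> 1 / M \<le> (1 - \<tau> r * r / (1 + r)) * (\<nu> r - \<eta> r * r)
      \<and> (1 - \<tau> r * r / (1 + r)) * (\<nu> r - \<eta> r * r) \<le> M
      \<and> 0 \<le> \<eta> r \<and> \<eta> r \<le> M \<and> r \<le> 1
      \<and> (\<nu> r + \<tau> r / (1 + r) * (1 - \<nu> r * r)) * r \<le> 1 / 2 \<and> 0 < 1 + r - \<tau> r * r
      \<and> \<tau> r / (1 + r - \<tau> r * r) * ((1 - \<tau> r * r / (1 + r)) * (\<nu> r - \<eta> r * r))
          / (2 * (1 - (\<nu> r + \<tau> r / (1 + r) * (1 - \<nu> r * r)) * r)) - \<eta> r \<le> K * r"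
    using parameter_bounds[OF assms(1-3)] unfolding \<eta>\<^sub>0_def \<nu>\<^sub>0_def \<tau>\<^sub>0_def by metis
  \<comment> \<open>Here \<open>s \<le> \<epsilon> / L\<close> says
    \<open>\<kappa> * r\<^sup>2 \<le> \<epsilon>\<close>, so \<open>\<epsilon>\<close> itself
    becomes \<open>C\<^sub>0\<close>; the entry \<open>\<delta>\<^sup>2\<close> of the minimum gives
    \<open>r \<le> \<delta>\<close> because
    \<open>r\<^sup>2 \<le> \<kappa> * r\<^sup>2\<close>.\<close>
  define \<epsilon> where "\<epsilon> = min (\<delta>\<^sup>2) (1 / (64 * M ^ 5 * (K + 1)))"
  have den: "0 < 64 * M ^ 5 * (K + 1)" using M K by auto
  have \<epsilon>: "0 < \<epsilon>" "\<epsilon> \<le> \<delta>\<^sup>2" "\<epsilon> * (64 * M ^ 5 * (K + 1)) \<le> 1"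
  proof -
    show "0 < \<epsilon>" "\<epsilon> \<le> \<delta>\<^sup>2" using \<delta> den by (auto simp: \<epsilon>_def)
    have "\<epsilon> \<le> 1 / (64 * M ^ 5 * (K + 1))" by (simp add: \<epsilon>_def)
    then show "\<epsilon> * (64 * M ^ 5 * (K + 1)) \<le> 1" using den by (simp only: pos_le_divide_eq)
  qed
  have "f (x k) - f xstar \<le> 40 * M ^ 4 * L * (norm (x 0 - xstar))\<^sup>2 * (1 - 1 / (320 * M ^ 9) * sqrt (\<mu> * s)) ^ k"
    if *: "0 < \<mu>" "\<mu> \<le> L" "f \<in> S1 n \<mu> L" "is_arg_min f (\<lambda>u. u \<in> Rn n) xstar"
      "0 < s" "s \<le> \<epsilon> / L"
      "algorithm_A n f \<mu> s (\<eta> (sqrt (\<mu> * s))) (\<nu> (sqrt (\<mu> * s))) (\<tau> (sqrt (\<mu> * s))) x y z"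
    for n \<mu> L f xstar s x y z k
  proof -
    define r where "r = sqrt (\<mu> * s)"
    have r: "0 < r" "r\<^sup>2 = \<mu> * s" using * by (simp_all add: r_def)
    have rk: "L / \<mu> * r\<^sup>2 \<le> \<epsilon>"
      using * by (simp add: r field_simps)
    moreover have "1 * r\<^sup>2 \<le> L / \<mu> * r\<^sup>2"
      using * by (intro mult_right_mono) auto
    ultimately have "r\<^sup>2 \<le> \<delta>\<^sup>2" using \<epsilon> by linarith
    then have "r \<le> \<delta>" using \<delta> by (simp add: power2_le_iff_abs_le)
    note bounds = bounds[OF r(1) this]
    interpret algorithm_run "Rn n" f "grad n f" \<mu> L xstar r "\<eta> r" "\<nu> r" "\<tau> r" x y z
      using * bounds by (intro algorithm_A_run[OF _ _ _ _ _ _ r_def]) (auto simp: r_def)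
    have "\<kappa> * r\<^sup>2 * (64 * M ^ 5 * (K + 1)) \<le> \<epsilon> * (64 * M ^ 5 * (K + 1))"
      using rk den by (intro mult_right_mono) (auto simp: \<kappa>_def)
    then have "\<kappa> * r\<^sup>2 * (64 * M ^ 5 * (K + 1)) \<le> 1" using \<epsilon> by linarith
    then show ?thesis
      unfolding r_def[symmetric]
      using bounds M K by (intro accelerated_convergence[of M K]) (simp_all only: a_def b_def c_def)
  qed
  then show "\<exists>C>0. \<exists>C\<^sub>0>0. \<exists>C\<^sub>1>0. \<forall>n \<mu> L f xstar s x y z.
          n \<ge> 1 \<and> 0 < \<mu> \<and> \<mu> \<le> L \<and> f \<in> S1 n \<mu> L \<and> is_arg_min f (\<lambda>u. u \<in> Rn n) xstar \<and>
          0 < s \<and> s \<le> C\<^sub>0 / L \<and>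
          algorithm_A n f \<mu> s (\<eta> (sqrt (\<mu> * s))) (\<nu> (sqrt (\<mu> * s))) (\<tau> (sqrt (\<mu> * s))) x y z \<longrightarrow>
          (\<forall>k\<ge>1. f (x k) - f xstar
                    \<le> C * L * (norm (x 0 - xstar))\<^sup>2 * (1 - C\<^sub>1 * sqrt (\<mu> * s)) ^ k)"
    using M \<epsilon> by (intro exI[of _ "40 * M ^ 4"] exI[of _ \<epsilon>] exI[of _ "1 / (320 * M ^ 9)"] conjI) auto
qed

end
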